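(* Fix $0<\alpha_0<\alpha_c=\frac{3\sqrt3}{2}$, and let $(\lambda_n)$ be a sequence of positive numbers with $0<\alpha_n:=\lambda_n/n\le\alpha_0$ and $\Lambda_n:=(\lambda_n n^2)^{1/3}\to\infty$. Then $$a_n(\lambda_n)=(-1)^n n^{-1/2}B(\alpha_n)H_e(\alpha_n)^n\left[\cos\bigl(n\Theta(\alpha_n)+\beta(\alpha_n)\bigr)+O(\Lambda_n^{-1})\right],$$ uniformly for $0<\alpha_n\le\alpha_0$. The error in brackets is additive (no lower bound on the cosine is assumed).
   Context: For $\lambda>0$, $F_\lambda(x)=\exp\!\left(-\lambda\frac{1-x}{1+x}\right)$ for $-1<x\le 1$ and $F_\lambda(-1)=0$. For $n\ge1$, $a_n(\lambda)=\frac2\pi\int_{-1}^1\frac{F_\lambda(x)T_n(x)}{\sqrt{1-x^2}}\,dx$, where $T_n$ is the Chebyshev polynomial of the first kind. For $0<\alpha<\alpha_c$ let $\zeta_\alpha$ be the unique root of $\alpha(\zeta^3-\zeta)+1=0$ in the open first quadrant, and $\psi_\alpha(\zeta)=\log\frac{\zeta-1}{\zeta+1}+\alpha\zeta^2$. At $\zeta=\zeta_\alpha$ the number $\frac{\zeta_\alpha-1}{\zeta_\alpha+1}$ lies in the open upper half-plane and the logarithm is the branch with argument in $(0,\pi)$ (the branch continuous in $\alpha$ that tends to $0$ as $\alpha\downarrow0$). Define $$H_e(\alpha)=\exp\bigl(\operatorname{Re}\psi_\alpha(\zeta_\alpha)\bigr),\qquad \Theta(\alpha)=\operatorname{Im}\psi_\alpha(\zeta_\alpha),$$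 $$C(\alpha)=\frac{4\sqrt\alpha}{\sqrt\pi}\,\frac{\zeta_\alpha}{\sqrt{3-2\alpha\zeta_\alpha}}=B(\alpha)e^{i\beta(\alpha)},$$ where $\sqrt{3-2\alpha\zeta_\alpha}$ is chosen continuously from the positive square root of $3$ as $\alpha\downarrow0$, $B(\alpha)=|C(\alpha)|>0$, and $\beta$ is a continuous argument of $C$ (with $\beta(\alpha)\to\pi/3$ as $\alpha\downarrow0$). *)

theory Defs
  imports "HOL-Analysis.Analysis"
begin

definition F :: "real \<Rightarrow> real \<Rightarrow> real" where
  "F lam x = (if x = -1 then 0 else exp (- lam * ((1 - x) / (1 + x))))"

fun cheb_T :: "nat \<Rightarrow> real \<Rightarrow> real" where
  "cheb_T 0 x = 1"
| "cheb_T (Suc 0) x = x"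
| "cheb_T (Suc (Suc n)) x = 2 * x * cheb_T (Suc n) x - cheb_T n x"

definition cheb_coeff :: "nat \<Rightarrow> real \<Rightarrow> real" where
  "cheb_coeff n lam =
     2 / pi * (LBINT x:{-1..1}. F lam x * cheb_T n x / sqrt (1 - x\<^sup>2))"

definition alpha_c :: real where
  "alpha_c = 3 * sqrt 3 / 2"

text \<open>The root is unique for parameters strictly between 0 and \<open>alpha_c\<close>; \<open>zeta\<close>, and everything
  built from it, is meaningful only on that interval.\<close>

definition zeta :: "real \<Rightarrow> complex" where
  "zeta \<alpha> = (THE z. Re z > 0 \<and> Im z > 0 \<and> of_real \<alpha> * (z ^ 3 - z) + 1 = 0)"

text \<open>For \<open>z\<close> in the open upper half-plane, so is \<open>(z - 1) / (z + 1)\<close>, and there the principal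
  \<open>Ln\<close> is the logarithm whose argument lies strictly between 0 and \<open>pi\<close>.\<close>

definition psi :: "real \<Rightarrow> complex \<Rightarrow> complex" where
  "psi \<alpha> z = Ln ((z - 1) / (z + 1)) + of_real \<alpha> * z\<^sup>2"

definition H_e :: "real \<Rightarrow> real" where
  "H_e \<alpha> = exp (Re (psi \<alpha> (zeta \<alpha>)))"

definition Theta :: "real \<Rightarrow> real" where
  "Theta \<alpha> = Im (psi \<alpha> (zeta \<alpha>))"

text \<open>The two branches below are specified by continuity together with their limit as the parameter
  decreases to 0. Each specification determines the function uniquely on the open interval from 0
  to \<open>alpha_c\<close>: the radicand \<open>3 - 2 * \<alpha> * zeta \<alpha>\<close> has negative imaginary part, hence never vanishes.\<close>

definition is_sqrt_branch :: "(real \<Rightarrow> complex) \<Rightarrow> bool" where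
  "is_sqrt_branch S \<longleftrightarrow>
     continuous_on {0<..<alpha_c} S \<and>
     (\<forall>\<alpha>\<in>{0<..<alpha_c}. (S \<alpha>)\<^sup>2 = 3 - 2 * of_real \<alpha> * zeta \<alpha>) \<and>
     (S \<longlongrightarrow> of_real (sqrt 3)) (at_right 0)"

definition amp_C :: "(real \<Rightarrow> complex) \<Rightarrow> real \<Rightarrow> complex" where
  "amp_C S \<alpha> = of_real (4 * sqrt \<alpha> / sqrt pi) * (zeta \<alpha> / S \<alpha>)"

definition amp_B :: "(real \<Rightarrow> complex) \<Rightarrow> real \<Rightarrow> real" where
  "amp_B S \<alpha> = cmod (amp_C S \<alpha>)"

definition is_arg_branch :: "(real \<Rightarrow> complex) \<Rightarrow> (real \<Rightarrow> real) \<Rightarrow> bool" where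
  "is_arg_branch S \<beta> \<longleftrightarrow>
     continuous_on {0<..<alpha_c} \<beta> \<and>
     (\<forall>\<alpha>\<in>{0<..<alpha_c}. amp_C S \<alpha> = of_real (amp_B S \<alpha>) * exp (\<i> * of_real (\<beta> \<alpha>))) \<and>
     (\<beta> \<longlongrightarrow> pi / 3) (at_right 0)"

end

theory Submission
  imports Defs "HOL-Complex_Analysis.Complex_Analysis" "HOL-Probability.Distributions"
begin

text \<open>The proof is the method of steepest descent, made uniform in the parameter by a scaling.

With \<open>x = cos \<theta>\<close> and \<open>y = tan (\<theta> / 2)\<close> the coefficient becomes an integral over the
imaginary axis of \<open>exp (n * psi \<alpha> z) / (1 - z\<^sup>2)\<close>. Put \<open>d\<close> for the real cube root of \<open>\<alpha>\<close> and
\<open>w = d * z\<close>. Then the saddle point equation is \<open>w ^ 3 - d\<^sup>2 * w + 1 = 0\<close>, whose root \<open>w0 = a + b * i\<close>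
in the first quadrant stays in a fixed compact set, with \<open>b\<close> bounded away from 0, as long as \<open>\<alpha>\<close> stays
below \<open>\<alpha>\<^sub>0\<close>; and the exponent is \<open>\<Lambda> = n * d\<close> times a phase that has a limit as \<open>d\<close> tends to 0.
So \<open>\<Lambda>\<close> is the only large parameter, and every constant may depend on a lower bound \<open>b0\<close> of \<open>b\<close> alone.

Write \<open>kern n d w\<close> for the exponential in the variable \<open>w\<close>. Its derivative is
\<open>2 * \<Lambda> * (1 / (w\<^sup>2 - d\<^sup>2) + w) * kern n d w\<close>, so up to a derivative the integrand
\<open>kern n d w / (d\<^sup>2 - w\<^sup>2)\<close> may be replaced by \<open>w * kern n d w\<close>. This removes the singular amplitude
at \<open>w = d\<close>, a point that the line \<open>Re w = a\<close> can meet. Then the line of integration is moved to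
\<open>Re w = a\<close> (\<open>kern_integral_shift\<close>).

On that line no further deformation is needed. The elementary inequality \<open>r \<le> exp (r - 1)\<close>, applied
to the ratio of the squared moduli of \<open>(w - d) / (w + d)\<close> at height \<open>y\<close> and at the saddle, bounds
\<open>kern\<close> by its value at the saddle times \<open>exp (- \<Lambda> * (y\<^sup>2 - b\<^sup>2)\<^sup>2 / ((a + d)\<^sup>2 + y\<^sup>2))\<close>
(\<open>norm_kern_vertical_line_le\<close>), and for \<open>y \<ge> 0\<close> the quotient in the exponent is at least a multiple
of \<open>(y - b)\<^sup>2\<close>. Near the saddle the phase is a cubic polynomial up to a fourth
order error with an explicit constant (\<open>kern_local_expansion\<close>). Both facts together show that the
integrand, divided by its value at the saddle, differs from a Gaussian times
\<open>1 + \<Lambda> * \<tau> * v ^ 3 + \<sigma> * v\<close> by at most \<open>C / \<Lambda> * exp (- c * \<Lambda> * v\<^sup>2)\<close> on the whole real line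
(\<open>saddle_integrand_near_gaussian\<close>). The two correction terms are odd and integrate to 0, and this
is why the relative error is of order \<open>1 / \<Lambda>\<close> and not \<open>1 / sqrt \<Lambda>\<close>.

It remains to identify the branches. The radicand \<open>3 - 2 * \<alpha> * zeta \<alpha>\<close> has positive real part, so
a continuous square root never crosses the imaginary axis and is the principal one
(\<open>sqrt_branch_Re_pos\<close>); this is also the root that the Gaussian integral produces. The argument
\<open>\<beta>\<close> enters through \<open>amp_C = amp_B * exp (i * \<beta>)\<close>, which makes the real part of the main term a
cosine.\<close>

section \<open>Gaussian integrals with complex parameter\<close>

lemma primitive_on_convex:
  assumes "f holomorphic_on S" "open S" "convex S"
  shows "\<exists>P. \<forall>w\<in>S. (P has_field_derivative f w) (at w)"
proof (rule holomorphic_convex_primitive'[OF assms(3,2,1)])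
  fix g assume "\<And>x. x \<in> S \<Longrightarrow> (g has_field_derivative f x) (at x within S)"
  then have "\<forall>w\<in>S. (g has_field_derivative f w) (at w)"
    using at_within_open[OF _ assms(2)] by metis
  then show ?thesis by blast
qed

text \<open>Improper integrals along rays are handled through primitives: a shift or a rotation of the ray
then only requires that the primitive vary little between the two end points.\<close>

lemma ray_integral_limit:
  fixes p d :: complex
  assumes P: "\<And>y. y \<ge> 0 \<Longrightarrow> (P has_field_derivative G (p + of_real y * d)) (at (p + of_real y * d))"
    and int: "set_integrable lborel {0..} (\<lambda>y. G (p + of_real y * d))"
  shows "((\<lambda>R. P (p + of_real R * d) - P p) \<longlongrightarrow>
           d * (LINT y:{0..}|lborel. G (p + of_real y * d))) at_top"
proof -
  have lim: "((\<lambda>R. LINT y:{0..R}|lborel. G (p + of_real y * d)) \<longlongrightarrow>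
           (LINT y:{0..}|lborel. G (p + of_real y * d))) at_top"
    using int by (intro tendsto_set_lebesgue_integral_at_top) auto
  have "d * (LINT y:{0..R}|lborel. G (p + of_real y * d)) = P (p + of_real R * d) - P p"
    if R: "R \<ge> 0" for R
  proof -
    have si: "set_integrable lborel {0..R} (\<lambda>y. G (p + of_real y * d))"
      by (rule set_integrable_subset[OF int]) auto
    have "((\<lambda>y. d * G (p + of_real y * d)) has_integral
              (P (p + of_real R * d) - P (p + of_real 0 * d))) {0..R}"
    proof (rule fundamental_theorem_of_calculus[OF R])
      fix y :: real assume "y \<in> {0..R}"
      then have "((\<lambda>y. P (p + of_real y * d)) has_vector_derivative
                    d * G (p + of_real y * d)) (at y)"
        by (intro field_vector_diff_chain_at[of "\<lambda>y. p + of_real y * d" d y P, unfolded o_def] P)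
           (auto intro!: derivative_eq_intros)
      then show "((\<lambda>y. P (p + of_real y * d)) has_vector_derivative
                    d * G (p + of_real y * d)) (at y within {0..R})"
        by (rule has_vector_derivative_at_within)
    qed
    moreover have "((\<lambda>y. d * G (p + of_real y * d)) has_integral
              d * integral {0..R} (\<lambda>y. G (p + of_real y * d))) {0..R}"
      using set_borel_integral_eq_integral(1)[OF si]
      by (intro has_integral_mult_right) (simp add: integrable_integral)
    ultimately show ?thesis
      using set_borel_integral_eq_integral(2)[OF si]
      by (metis (no_types, lifting) add.right_neutral has_integral_unique mult_zero_left of_real_0)
  qed
  then have "\<forall>\<^sub>F R in at_top. d * (LINT y:{0..R}|lborel. G (p + of_real y * d)) =
               P (p + of_real R * d) - P p"
    by (intro eventually_mono[OF eventually_ge_at_top[of 0]]) auto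
  with tendsto_mult_left[OF lim, of d] show ?thesis
    by (rule Lim_transform_eventually)
qed

lemma complex_gaussian_set_integrable:
  fixes z :: complex
  assumes z: "Re z > 0"
  shows "set_integrable lborel {0..} (\<lambda>v::real. exp (- z * of_real (v\<^sup>2)))"
proof -
  have "has_bochner_integral lborel (\<lambda>v::real. exp (- (v\<^sup>2))) (2 *\<^sub>R (sqrt pi / 2))"
    by (rule has_bochner_integral_even_function[OF gaussian_moment_0]) auto
  then have "integrable lborel (\<lambda>v::real. exp (- (v\<^sup>2)))"
    by (simp add: has_bochner_integral_iff)
  then have "integrable lborel (\<lambda>v::real. exp (- ((0 + sqrt (Re z) * v)\<^sup>2)))"
    using z by (intro lborel_integrable_real_affine) auto
  then have "integrable lborel (\<lambda>v::real. exp (- (Re z * v\<^sup>2)))"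
    using z by (simp add: power_mult_distrib)
  then have "integrable lborel (\<lambda>v::real. exp (- z * of_real (v\<^sup>2)))"
    by (rule Bochner_Integration.integrable_bound) (auto simp del: of_real_power)
  then show ?thesis
    unfolding set_integrable_def by (rule integrable_mult_indicator[rotated]) auto
qed

text \<open>The substitution \<open>w = csqrt z * v\<close> turns the integrand into \<open>exp (- w\<^sup>2)\<close> on the ray through
\<open>s = csqrt z\<close>. Since \<open>Re z > 0\<close>, this ray lies in the sector where \<open>exp (- w\<^sup>2)\<close> decays, and it can be
rotated to the positive real axis. The end points \<open>R * s\<close> and \<open>R * Re s\<close> are joined by a vertical
segment, on which the modulus is at most \<open>exp (- Re z * R\<^sup>2)\<close>.\<close>

lemma complex_gaussian_half_line:
  fixes z :: complex
  assumes z: "Re z > 0"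
  shows "(LINT v:{0..}|lborel. exp (- z * of_real (v\<^sup>2))) = of_real (sqrt pi / 2) / csqrt z"
proof -
  define s where "s = csqrt z"
  have s2: "s\<^sup>2 = z" by (simp add: s_def)
  have Re_s: "Re s > 0"
  proof -
    have "Re s \<ge> 0" using csqrt_principal[of z] by (auto simp: s_def)
    moreover have "Re s \<noteq> 0"
    proof
      assume "Re s = 0"
      then have "Re (s\<^sup>2) \<le> 0" by (simp add: power2_eq_square)
      with z s2 show False by simp
    qed
    ultimately show ?thesis by simp
  qed
  have s_sq: "(Re s)\<^sup>2 - (Im s)\<^sup>2 = Re z"
    using s2 by (auto simp: power2_eq_square)
  have real_gauss: "(LINT v:{0..}|lborel. exp (- (v\<^sup>2))) = sqrt pi / 2"
    using gaussian_moment_0 unfolding set_lebesgue_integral_def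
    by (simp_all add: has_bochner_integral_iff)
  have I: "set_integrable lborel {0..} (\<lambda>v::real. exp (- z * of_real (v\<^sup>2)))"
    by (rule complex_gaussian_set_integrable[OF z])
  have hol: "(\<lambda>w::complex. exp (- (w\<^sup>2))) holomorphic_on UNIV"
    by (intro holomorphic_intros)
  from primitive_on_convex[OF hol open_UNIV convex_UNIV]
  obtain P where "\<forall>w\<in>UNIV. (P has_field_derivative exp (- ((w::complex)\<^sup>2))) (at w)" ..
  then have P: "(P has_field_derivative exp (- (w\<^sup>2))) (at w)" for w
    by (rule bspec) simp
  have lim1: "((\<lambda>R. P (of_real R * s) - P 0) \<longlongrightarrow>
      s * (LINT v:{0..}|lborel. exp (- z * of_real (v\<^sup>2)))) at_top"
  proof -
    have eq: "exp (- ((0 + of_real v * s)\<^sup>2)) = exp (- z * of_real (v\<^sup>2))" for v :: real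
      by (simp add: power_mult_distrib s2 mult.commute)
    show ?thesis
      using ray_integral_limit[where p = 0 and d = s and P = P and G = "\<lambda>w. exp (- (w\<^sup>2))", OF P, unfolded eq, OF I] by simp
  qed
  have "set_integrable lborel {0..} (\<lambda>y. exp (- (complex_of_real y)\<^sup>2))"
    using complex_gaussian_set_integrable[of 1] by simp
  moreover have "(LINT y:{0..}|lborel. exp (- (complex_of_real y)\<^sup>2)) = of_real (sqrt pi / 2)"
    using set_integral_complex_of_real[of lborel "{0..}" "\<lambda>y. exp (- (y\<^sup>2))"]
    unfolding real_gauss by (simp add: exp_of_real[symmetric])
  moreover have "((\<lambda>R. P (of_real R) - P 0) \<longlongrightarrow> (LINT y:{0..}|lborel. exp (- (complex_of_real y)\<^sup>2))) at_top"
    using ray_integral_limit[where p = 0 and d = 1 and P = P and G = "\<lambda>w. exp (- (w\<^sup>2))", OF P]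
      calculation(1) by simp
  ultimately have "((\<lambda>R. P (of_real R) - P 0) \<longlongrightarrow> of_real (sqrt pi / 2)) at_top"
    by (simp only:)
  moreover have "filterlim (\<lambda>R. R * Re s) at_top at_top"
    using Re_s by real_asymp
  ultimately have lim2: "((\<lambda>R. P (of_real (R * Re s)) - P 0) \<longlongrightarrow> of_real (sqrt pi / 2)) at_top"
    by (rule filterlim_compose)
  have "((\<lambda>R. P (of_real R * s) - P (of_real (R * Re s))) \<longlongrightarrow> 0) at_top"
  proof (rule Lim_null_comparison)
    show "((\<lambda>R. exp (- Re z * R\<^sup>2) * (R * \<bar>Im s\<bar>)) \<longlongrightarrow> 0) at_top"
      using z by real_asymp
    show "\<forall>\<^sub>F R in at_top. norm (P (of_real R * s) - P (of_real (R * Re s)))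
            \<le> exp (- Re z * R\<^sup>2) * (R * \<bar>Im s\<bar>)"
      using eventually_ge_at_top[of 0]
    proof eventually_elim
      fix R :: real assume R: "0 \<le> R"
      define Seg where "Seg = closed_segment (complex_of_real R * s) (of_real (R * Re s))"
      have "norm (P (of_real R * s) - P (of_real (R * Re s)))
              \<le> exp (- Re z * R\<^sup>2) * norm (of_real R * s - of_real (R * Re s))"
      proof (rule field_differentiable_bound[of Seg P "\<lambda>w. exp (- (w\<^sup>2))"])
        fix w assume "w \<in> Seg"
        then obtain u where u: "0 \<le> u" "u \<le> 1"
          and w: "w = (1 - u) *\<^sub>R (complex_of_real R * s) + u *\<^sub>R of_real (R * Re s)"
          by (auto simp: Seg_def closed_segment_def)
        have Re_w: "Re w = R * Re s" by (simp add: w algebra_simps)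
        have Im_w: "Im w = (1 - u) * (R * Im s)" by (simp add: w)
        have "(Im w)\<^sup>2 \<le> (R * Im s)\<^sup>2"
          unfolding Im_w power_mult_distrib using u by (intro mult_left_le_one_le) (auto simp: abs_square_le_1 power_le_one)
        then have "(Im w)\<^sup>2 - (Re w)\<^sup>2 \<le> - Re z * R\<^sup>2"
          unfolding Re_w s_sq[symmetric] by (simp add: algebra_simps)
        then show "norm (exp (- (w\<^sup>2))) \<le> exp (- Re z * R\<^sup>2)"
          by (simp add: power2_eq_square)
      qed (auto simp: Seg_def intro: has_field_derivative_at_within P)
      also have "of_real R * s - of_real (R * Re s) = \<i> * of_real (R * Im s)"
        by (simp add: complex_eq_iff)
      finally show "norm (P (of_real R * s) - P (of_real (R * Re s)))
            \<le> exp (- Re z * R\<^sup>2) * (R * \<bar>Im s\<bar>)"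
        using R by (simp add: norm_mult abs_mult)
    qed
  qed
  from tendsto_add[OF this lim2] have "((\<lambda>R. P (of_real R * s) - P 0) \<longlongrightarrow> of_real (sqrt pi / 2)) at_top"
    by simp
  with lim1 have "s * (LINT v:{0..}|lborel. exp (- z * of_real (v\<^sup>2))) = of_real (sqrt pi / 2)"
    by (intro tendsto_unique[of at_top]) auto
  moreover have "s \<noteq> 0" using Re_s by auto
  ultimately show ?thesis by (simp add: s_def[symmetric] field_simps)
qed

text \<open>Trades half of the exponential decay for a cubic polynomial factor; error terms like
\<open>\<Lambda>\<^sup>2 * v ^ 6\<close> are absorbed in this way, and only plain Gaussians remain to be integrated.\<close>

lemma cubic_le_exp:
  fixes q x :: real
  assumes q: "q > 0" and x: "x \<ge> 0"
  shows "(1 + x) ^ 3 * exp (- q * x) \<le> (max 1 (6 / q)) ^ 3 * exp (- q * x / 2)"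
proof -
  define c where "c = max 1 (6 / q)"
  have c: "c \<ge> 1" "c * q \<ge> 6" using q by (auto simp: c_def field_simps max_def)
  have "1 + x \<le> c * (1 + q * x / 6)"
  proof -
    have "6 * x \<le> (c * q) * x" using c x by (intro mult_right_mono) auto
    with c show ?thesis by (simp add: field_simps)
  qed
  also have "\<dots> \<le> c * exp (q * x / 6)"
    using c exp_ge_add_one_self[of "q * x / 6"] by (intro mult_left_mono) auto
  finally have "(1 + x) ^ 3 \<le> (c * exp (q * x / 6)) ^ 3"
    using x by (intro power_mono) auto
  also have "\<dots> = c ^ 3 * exp (q * x / 2)"
    by (simp add: power_mult_distrib exp_of_nat_mult[symmetric])
  finally have "(1 + x) ^ 3 * exp (- q * x) \<le> c ^ 3 * exp (q * x / 2) * exp (- q * x)"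
    by (intro mult_right_mono) auto
  also have "\<dots> = c ^ 3 * exp (- q * x / 2)"
    by (simp add: mult.assoc exp_add[symmetric])
  finally show ?thesis by (simp add: c_def)
qed

lemma real_gaussian:
  fixes p :: real
  assumes p: "p > 0"
  shows "has_bochner_integral lborel (\<lambda>v. exp (- p * v\<^sup>2)) (sqrt (pi / p))"
proof -
  have "has_bochner_integral lborel (\<lambda>v::real. exp (- (v\<^sup>2))) (2 *\<^sub>R (sqrt pi / 2))"
    by (rule has_bochner_integral_even_function[OF gaussian_moment_0]) auto
  then have "has_bochner_integral lborel (\<lambda>v::real. exp (- ((0 + sqrt p * v)\<^sup>2)))
               ((2 *\<^sub>R (sqrt pi / 2)) /\<^sub>R \<bar>sqrt p\<bar>)"
    using p by (subst (asm) lborel_has_bochner_integral_real_affine_iff[of "sqrt p" _ _ 0]) auto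
  then show ?thesis
    using p by (simp add: power_mult_distrib real_sqrt_divide field_simps)
qed

lemma complex_gaussian:
  fixes z :: complex
  assumes z: "Re z > 0"
  shows "has_bochner_integral lborel (\<lambda>v::real. exp (- z * of_real (v\<^sup>2))) (of_real (sqrt pi) / csqrt z)"
proof -
  have "has_bochner_integral lborel (\<lambda>v. indicator {0..} v *\<^sub>R exp (- z * of_real (v\<^sup>2)))
          (of_real (sqrt pi / 2) / csqrt z)"
    using complex_gaussian_set_integrable[OF z] complex_gaussian_half_line[OF z]
    by (simp add: has_bochner_integral_iff set_integrable_def set_lebesgue_integral_def)
  from has_bochner_integral_even_function[OF this] show ?thesis
    by (simp add: scaleR_conv_of_real)
qed

lemma complex_gaussian_odd:
  fixes z :: complex
  assumes z: "Re z > 0" and k: "k \<le> 3" "odd k"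
  shows "has_bochner_integral lborel (\<lambda>v::real. exp (- z * of_real (v\<^sup>2)) * of_real v ^ k) 0"
proof -
  let ?f = "\<lambda>v::real. exp (- z * of_real (v\<^sup>2)) * of_real v ^ k"
  define p where "p = Re z / 2"
  have "integrable lborel (\<lambda>v::real. (max 1 (6 / Re z)) ^ 3 * exp (- p * v\<^sup>2))"
    using real_gaussian[of p] z by (intro integrable_mult_right) (auto simp: has_bochner_integral_iff p_def)
  then have int: "integrable lborel ?f"
  proof (rule Bochner_Integration.integrable_bound)
    show "AE v in lborel. norm (?f v) \<le> norm ((max 1 (6 / Re z)) ^ 3 * exp (- p * v\<^sup>2))"
    proof (intro AE_I2)
      fix v :: real
      have "\<bar>v\<bar> \<le> 1 + v\<^sup>2"
        using sum_power2_ge_zero[of "\<bar>v\<bar> - 1/2" 0] by (simp add: power2_eq_square algebra_simps)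
      then have "\<bar>v\<bar> ^ k \<le> (1 + v\<^sup>2) ^ k" by (intro power_mono) auto
      also have "\<dots> \<le> (1 + v\<^sup>2) ^ 3" using k by (intro power_increasing) auto
      finally have "\<bar>v\<bar> ^ k * exp (- Re z * v\<^sup>2) \<le> (1 + v\<^sup>2) ^ 3 * exp (- Re z * v\<^sup>2)"
        by (intro mult_right_mono) auto
      also have "\<dots> \<le> (max 1 (6 / Re z)) ^ 3 * exp (- Re z * v\<^sup>2 / 2)"
        by (rule cubic_le_exp) (use z in auto)
      finally show "norm (?f v) \<le> norm ((max 1 (6 / Re z)) ^ 3 * exp (- p * v\<^sup>2))"
        by (simp add: norm_mult norm_power p_def mult.commute del: of_real_power)
    qed
  qed auto
  then have "has_bochner_integral lborel (\<lambda>v. indicator {0..} v *\<^sub>R ?f v)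
               (\<integral>v. indicator {0..} v *\<^sub>R ?f v \<partial>lborel)"
    by (intro has_bochner_integral_integrable integrable_mult_indicator) auto
  then show ?thesis
    by (rule has_bochner_integral_odd_function) (use k in auto)
qed

text \<open>The odd corrections \<open>\<mu> * v ^ 3\<close> and \<open>\<sigma> * v\<close> contribute nothing to the integral, so they may be
subtracted from the integrand before the error is estimated.\<close>

lemma integral_near_gaussian:
  fixes E :: "real \<Rightarrow> complex" and z \<mu> \<sigma> :: complex and p M :: real
  assumes meas: "E \<in> borel_measurable borel"
    and z: "Re z > 0" and p: "p > 0"
    and close: "\<And>v. norm (E v - exp (- z * of_real (v\<^sup>2)) * (1 + \<mu> * of_real v ^ 3 + \<sigma> * of_real v))
                  \<le> M * exp (- p * v\<^sup>2)"
  shows "norm ((\<integral>v. E v \<partial>lborel) - of_real (sqrt pi) / csqrt z) \<le> M * sqrt (pi / p)"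
proof -
  let ?g = "\<lambda>v::real. exp (- z * of_real (v\<^sup>2)) * (1 + \<mu> * of_real v ^ 3 + \<sigma> * of_real v)"
  have "has_bochner_integral lborel
      (\<lambda>v. exp (- z * of_real (v\<^sup>2)) + \<mu> * (exp (- z * of_real (v\<^sup>2)) * of_real v ^ 3)
           + \<sigma> * (exp (- z * of_real (v\<^sup>2)) * of_real v ^ 1))
      (of_real (sqrt pi) / csqrt z + \<mu> * 0 + \<sigma> * 0)"
    by (intro has_bochner_integral_add has_bochner_integral_mult_right complex_gaussian
         complex_gaussian_odd z) auto
  then have g: "has_bochner_integral lborel ?g (of_real (sqrt pi) / csqrt z)"
    by (simp add: algebra_simps)
  have G: "has_bochner_integral lborel (\<lambda>v. M * exp (- p * v\<^sup>2)) (M * sqrt (pi / p))"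
    by (intro has_bochner_integral_mult_right real_gaussian p)
  then have "integrable lborel (\<lambda>v. M * exp (- p * v\<^sup>2))"
    by (simp add: has_bochner_integral_iff)
  then have diff: "integrable lborel (\<lambda>v. E v - ?g v)"
  proof (rule Bochner_Integration.integrable_bound)
    show "AE v in lborel. norm (E v - ?g v) \<le> norm (M * exp (- p * v\<^sup>2))"
      using order_trans[OF close abs_ge_self] by (intro AE_I2) simp
  qed (use meas in measurable)
  have "integrable lborel (\<lambda>v. (E v - ?g v) + ?g v)"
    using diff g by (intro Bochner_Integration.integrable_add) (simp_all add: has_bochner_integral_iff)
  then have E: "integrable lborel E" by simp
  have eq: "(\<integral>v. E v \<partial>lborel) - of_real (sqrt pi) / csqrt z = (\<integral>v. E v - ?g v \<partial>lborel)"
    using E g by (simp add: has_bochner_integral_iff)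
  have "norm (\<integral>v. E v - ?g v \<partial>lborel) \<le> (\<integral>v. norm (E v - ?g v) \<partial>lborel)"
    by (rule integral_norm_bound)
  also have "\<dots> \<le> (\<integral>v. M * exp (- p * v\<^sup>2) \<partial>lborel)"
  proof (rule integral_mono)
    show "integrable lborel (\<lambda>v. norm (E v - ?g v))"
      using diff by (rule integrable_norm)
    show "integrable lborel (\<lambda>v. M * exp (- p * v\<^sup>2))"
      using G by (simp add: has_bochner_integral_iff)
  qed (rule close)
  also have "\<dots> = M * sqrt (pi / p)"
    using G by (simp add: has_bochner_integral_iff)
  finally show "norm ((\<integral>v. E v \<partial>lborel) - of_real (sqrt pi) / csqrt z) \<le> M * sqrt (pi / p)"
    unfolding eq .
qed

section \<open>From the Chebyshev coefficient to an integral over the imaginary axis\<close>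

text \<open>This is \<open>exp (n * psi \<alpha> z)\<close> for \<open>\<alpha> = d ^ 3\<close> and \<open>z = w / d\<close>. The logarithm is replaced by a power, so
that the function is defined and holomorphic on the half-plane \<open>Re w > - d\<close>, across the cut from
\<open>- d\<close> to \<open>d\<close> of the phase itself.\<close>

definition kern :: "nat \<Rightarrow> real \<Rightarrow> complex \<Rightarrow> complex" where
  "kern n d w = ((w - of_real d) / (w + of_real d)) ^ n * exp (of_real (real n * d) * w\<^sup>2)"

text \<open>Every \<open>u\<close> on the unit circle satisfies \<open>u\<^sup>2 = 2 * Re u * u - 1\<close>, hence its powers obey the recursion
of the Chebyshev polynomials.\<close>

lemma cheb_T_Re_unit_circle:
  assumes "cmod u = 1"
  shows "cheb_T n (Re u) = Re (u ^ n)"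
proof -
  have "u * cnj u = 1" using assms by (simp add: complex_norm_square[symmetric])
  moreover have "2 * of_real (Re u) = u + cnj u" by (simp add: complex_add_cnj)
  ultimately have quad: "u * u = 2 * of_real (Re u) * u - 1"
    by (simp add: distrib_right distrib_left mult.commute)
  have "cheb_T n (Re u) = Re (u ^ n) \<and> cheb_T (Suc n) (Re u) = Re (u ^ Suc n)"
  proof (induction n)
    case (Suc n)
    have "u ^ Suc (Suc n) = u * u * u ^ n" by (simp add: mult.assoc)
    also have "\<dots> = of_real (2 * Re u) * u ^ Suc n - u ^ n" 
      unfolding quad by (simp add: algebra_simps)
    finally have "Re (u ^ Suc (Suc n)) = 2 * Re u * Re (u ^ Suc n) - Re (u ^ n)"
      by (simp only: Re_complex_of_real Im_complex_of_real minus_complex.sel times_complex.sel)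
    with Suc show ?case by simp
  qed simp
  then show ?thesis ..
qed

lemma continuous_on_cheb_T: "continuous_on A (cheb_T n)"
proof -
  have "continuous_on A (\<lambda>x. cheb_T n x) \<and> continuous_on A (\<lambda>x. cheb_T (Suc n) x)"
    by (induction n) (auto intro!: continuous_intros)
  then show ?thesis by simp
qed

lemma norm_kern_le:
  assumes "d > 0" "Re w \<ge> 0"
  shows "cmod (kern n d w) \<le> exp (real n * d * ((Re w)\<^sup>2 - (Im w)\<^sup>2))"
proof -
  have "cmod (w - of_real d) \<le> cmod (w + of_real d)"
    using assms unfolding cmod_def by (intro real_sqrt_le_mono) (simp add: power2_eq_square algebra_simps)
  then have "cmod ((w - of_real d) / (w + of_real d)) \<le> 1"
    by (simp add: norm_divide divide_le_eq)
  then have "cmod (((w - of_real d) / (w + of_real d)) ^ n) \<le> 1"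
    by (simp add: norm_power power_le_one)
  then have "cmod (kern n d w) \<le> 1 * cmod (exp (of_real (real n * d) * w\<^sup>2))"
    unfolding kern_def norm_mult by (intro mult_right_mono) auto
  also have "\<dots> = exp (real n * d * ((Re w)\<^sup>2 - (Im w)\<^sup>2))"
    by (simp add: power2_eq_square algebra_simps)
  finally show ?thesis .
qed

lemma continuous_on_kern_vertical:
  assumes "d > 0" "a \<ge> 0"
  shows "continuous_on A (\<lambda>y. kern n d (of_real a + of_real y * \<i>))"
proof -
  have "of_real a + of_real y * \<i> + of_real d \<noteq> 0" for y
    using assms by (simp add: complex_eq_iff)
  then show ?thesis
    unfolding kern_def by (intro continuous_intros) auto
qed

lemma integrable_kern_imaginary_axis:
  assumes d: "d > 0" and n: "n \<ge> 1"
  shows "integrable lborel (\<lambda>y. kern n d (of_real y * \<i>) / of_real (d\<^sup>2 + y\<^sup>2))"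
proof (rule Bochner_Integration.integrable_bound)
  show "integrable lborel (\<lambda>y. 1 / d\<^sup>2 * exp (- (real n * d) * y\<^sup>2))"
    using real_gaussian[of "real n * d"] d n
    by (intro integrable_mult_right) (simp add: has_bochner_integral_iff)
  have nz: "complex_of_real (d\<^sup>2 + y\<^sup>2) \<noteq> 0" for y
    using d by (simp add: of_real_eq_0_iff sum_power2_eq_zero_iff del: of_real_add of_real_power)
  have "continuous_on UNIV (\<lambda>y. kern n d (of_real y * \<i>) / of_real (d\<^sup>2 + y\<^sup>2))"
    using continuous_on_kern_vertical[OF d order.refl, of UNIV n] nz
    by (intro continuous_on_divide continuous_intros) auto
  then show "(\<lambda>y. kern n d (of_real y * \<i>) / of_real (d\<^sup>2 + y\<^sup>2)) \<in> borel_measurable lborel"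
    by (simp add: borel_measurable_continuous_onI)
  show "AE y in lborel. norm (kern n d (of_real y * \<i>) / of_real (d\<^sup>2 + y\<^sup>2))
          \<le> norm (1 / d\<^sup>2 * exp (- (real n * d) * y\<^sup>2))"
  proof (intro AE_I2)
    fix y :: real
    have "cmod (kern n d (of_real y * \<i>)) \<le> exp (- (real n * d) * y\<^sup>2)"
      using norm_kern_le[OF d, of "of_real y * \<i>" n] by simp
    moreover have "d\<^sup>2 \<le> cmod (of_real (d\<^sup>2 + y\<^sup>2))"
      unfolding norm_of_real by simp
    ultimately have "cmod (kern n d (of_real y * \<i>)) / cmod (of_real (d\<^sup>2 + y\<^sup>2))
        \<le> exp (- (real n * d) * y\<^sup>2) / d\<^sup>2"
      using d by (intro frac_le) auto
    then show "norm (kern n d (of_real y * \<i>) / of_real (d\<^sup>2 + y\<^sup>2))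
          \<le> norm (1 / d\<^sup>2 * exp (- (real n * d) * y\<^sup>2))"
      by (simp add: norm_divide norm_mult del: of_real_add of_real_power)
  qed
qed

text \<open>The substitution \<open>x = (d\<^sup>2 - y\<^sup>2) / (d\<^sup>2 + y\<^sup>2)\<close> makes \<open>x\<close> the real part of the unimodular number
\<open>(d - i * y) / (d + i * y)\<close> and turns \<open>(1 - x) / (1 + x)\<close> into \<open>y\<^sup>2 / d\<^sup>2\<close>. The sign \<open>(-1) ^ n\<close> arises because this
number is minus the quotient in \<open>kern\<close>.\<close>

lemma cheb_coeff_eq_half_line:
  assumes d: "d > 0" and n: "n \<ge> 1"
  shows "cheb_coeff n (real n * d ^ 3) =
    (-1) ^ n * (4 / pi) * d * Re (LINT y:{0..}|lborel. kern n d (of_real y * \<i>) / of_real (d\<^sup>2 + y\<^sup>2))"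
proof -
  define f where "f x = F (real n * d ^ 3) x * cheb_T n x / sqrt (1 - x\<^sup>2)" for x
  define g where "g y = (d\<^sup>2 - y\<^sup>2) / (d\<^sup>2 + y\<^sup>2)" for y
  define g' where "g' y = - 4 * d\<^sup>2 * y / (d\<^sup>2 + y\<^sup>2)\<^sup>2" for y
  define h where "h y = (-1) ^ n * (2 * d) * Re (kern n d (of_real y * \<i>) / of_real (d\<^sup>2 + y\<^sup>2))" for y
  have pos: "d\<^sup>2 + y\<^sup>2 > 0" for y using d by (simp add: add_pos_nonneg)
  have nz: "d\<^sup>2 + y\<^sup>2 \<noteq> 0" for y using less_imp_neq[OF pos[of y]] by simp
  have g1: "1 + g y = 2 * d\<^sup>2 / (d\<^sup>2 + y\<^sup>2)" "1 - g y = 2 * y\<^sup>2 / (d\<^sup>2 + y\<^sup>2)" for y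
    using nz[of y] unfolding g_def by (simp_all add: add_divide_eq_iff diff_divide_eq_iff)
  have [measurable]: "cheb_T n \<in> borel_measurable borel"
    by (intro borel_measurable_continuous_onI continuous_on_cheb_T)
  have f_meas: "f \<in> borel_measurable borel"
    unfolding f_def F_def by measurable
  have h_int: "integrable lborel h"
    unfolding h_def
    by (intro integrable_mult_right integrable_Re integrable_kern_imaginary_axis d n)
  have image: "g ` {0<..} = {-1<..<1}"
  proof (intro equalityI subsetI)
    fix x assume "x \<in> g ` {0<..}"
    then obtain y where "y > 0" "x = g y" by auto
    moreover note g1[of y]
    moreover have "2 * d\<^sup>2 / (d\<^sup>2 + y\<^sup>2) > 0" "2 * y\<^sup>2 / (d\<^sup>2 + y\<^sup>2) > 0"
      using pos[of y] d \<open>y > 0\<close> by (simp_all add: zero_less_divide_iff)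
    ultimately show "x \<in> {-1<..<1}" by simp
  next
    fix x :: real assume x: "x \<in> {-1<..<1}"
    define y where "y = d * sqrt ((1 - x) / (1 + x))"
    define t where "t = (1 - x) / (1 + x)"
    have "y\<^sup>2 = d\<^sup>2 * t" using x by (simp add: y_def t_def power_mult_distrib)
    then have "d\<^sup>2 - y\<^sup>2 = d\<^sup>2 * (1 - t)" "d\<^sup>2 + y\<^sup>2 = d\<^sup>2 * (1 + t)"
      by (simp_all add: algebra_simps)
    then have "g y = (1 - t) / (1 + t)"
      using d by (simp add: g_def)
    also have "\<dots> = x"
    proof -
      have nz: "1 + x \<noteq> 0" using x by auto
      have "1 - t = 2 * x / (1 + x)" "1 + t = 2 / (1 + x)"
        using nz by (simp_all add: t_def diff_divide_eq_iff add_divide_eq_iff)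
      with nz show ?thesis by simp
    qed
    finally show "x \<in> g ` {0<..}" using x d by (intro image_eqI[of _ _ y]) (auto simp: y_def)
  qed
  have inj: "inj_on g {0<..}"
  proof (rule inj_onI)
    fix x y assume xy: "x \<in> {0<..}" "y \<in> {0<..}" "g x = g y"
    then have "(d\<^sup>2 - x\<^sup>2) * (d\<^sup>2 + y\<^sup>2) = (d\<^sup>2 - y\<^sup>2) * (d\<^sup>2 + x\<^sup>2)"
      using less_imp_neq[OF pos[of x]] less_imp_neq[OF pos[of y]] by (simp add: g_def frac_eq_eq)
    then have "d\<^sup>2 * x\<^sup>2 = d\<^sup>2 * y\<^sup>2"
      by (auto simp: algebra_simps)
    with d have "x\<^sup>2 = y\<^sup>2" by simp
    with xy show "x = y" using power2_eq_imp_eq[of x y] by simp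
  qed
  have der: "(g has_field_derivative g' y) (at y within {0<..})" for y
  proof -
    have "((\<lambda>y. d\<^sup>2 - y\<^sup>2) has_field_derivative - 2 * y) (at y within {0<..})"
      by (auto intro!: derivative_eq_intros)
    moreover have "((\<lambda>y. d\<^sup>2 + y\<^sup>2) has_field_derivative 2 * y) (at y within {0<..})"
      by (auto intro!: derivative_eq_intros)
    ultimately have "((\<lambda>y. (d\<^sup>2 - y\<^sup>2) / (d\<^sup>2 + y\<^sup>2)) has_field_derivative
        (- 2 * y * (d\<^sup>2 + y\<^sup>2) - (d\<^sup>2 - y\<^sup>2) * (2 * y)) / ((d\<^sup>2 + y\<^sup>2) * (d\<^sup>2 + y\<^sup>2)))
        (at y within {0<..})"
      by (rule DERIV_divide) (rule nz)
    moreover have "- 2 * y * (d\<^sup>2 + y\<^sup>2) - (d\<^sup>2 - y\<^sup>2) * (2 * y) = - 4 * d\<^sup>2 * y"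
      by (simp add: algebra_simps)
    ultimately show ?thesis
      unfolding g_def g'_def by (simp add: power2_eq_square)
  qed
  have transform: "\<bar>g' y\<bar> * f (g y) = h y" if y: "y \<in> {0<..}" for y
  proof -
    define u where "u = (of_real d - of_real y * \<i>) / (of_real d + of_real y * \<i>)"
    have u_nz: "of_real d + of_real y * \<i> \<noteq> 0" using d by (simp add: complex_eq_iff)
    have norm_u: "cmod u = 1"
    proof -
      have "cmod (of_real d - of_real y * \<i>) = cmod (of_real d + of_real y * \<i>)" by (simp add: cmod_def)
      with u_nz show ?thesis by (simp add: u_def norm_divide)
    qed
    have Re_u: "Re u = g y"
      by (simp add: u_def g_def Re_divide power2_eq_square)
    have T: "cheb_T n (g y) = Re (u ^ n)"
      using cheb_T_Re_unit_circle[OF norm_u, of n] by (simp add: Re_u)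
    have u_neg: "u = - ((of_real y * \<i> - of_real d) / (of_real y * \<i> + of_real d))"
      using u_nz by (simp add: u_def add.commute minus_divide_left)
    have sq: "1 - (g y)\<^sup>2 = (2 * d * y / (d\<^sup>2 + y\<^sup>2))\<^sup>2"
    proof -
      have "1 - (g y)\<^sup>2 = (1 - g y) * (1 + g y)" by (simp add: power2_eq_square algebra_simps)
      then show ?thesis unfolding g1 by (simp add: power2_eq_square)
    qed
    have root: "sqrt (1 - (g y)\<^sup>2) = 2 * d * y / (d\<^sup>2 + y\<^sup>2)"
      unfolding sq using d y pos[of y] by (simp only: real_sqrt_abs) simp
    have quot: "(1 - g y) / (1 + g y) = y\<^sup>2 / d\<^sup>2"
      unfolding g1 using nz[of y] by simp
    have "g y \<noteq> -1" using image y by force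
    then have Fg: "F (real n * d ^ 3) (g y) = exp (- (real n * d * y\<^sup>2))"
      using d by (simp add: F_def quot power3_eq_cube power2_eq_square)
    have kern_iy: "kern n d (of_real y * \<i>) = (-1) ^ n * u ^ n * of_real (exp (- (real n * d * y\<^sup>2)))"
      by (simp add: kern_def u_neg power_mult_distrib exp_of_real[symmetric] power_minus')
    have fac: "\<bar>g' y\<bar> / sqrt (1 - (g y)\<^sup>2) = 2 * d / (d\<^sup>2 + y\<^sup>2)"
    proof -
      have "\<bar>g' y\<bar> = 2 * d / (d\<^sup>2 + y\<^sup>2) * (2 * d * y / (d\<^sup>2 + y\<^sup>2))"
        using d y by (simp add: g'_def abs_mult power2_eq_square)
      moreover have "2 * d * y / (d\<^sup>2 + y\<^sup>2) \<noteq> 0" using d y nz[of y] by simp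
      ultimately show ?thesis unfolding root by (metis nonzero_mult_div_cancel_right)
    qed
    have "\<bar>g' y\<bar> * f (g y) = \<bar>g' y\<bar> / sqrt (1 - (g y)\<^sup>2) * (exp (- (real n * d * y\<^sup>2)) * Re (u ^ n))"
      by (simp add: f_def Fg T)
    also have "\<dots> = 2 * d / (d\<^sup>2 + y\<^sup>2) * (exp (- (real n * d * y\<^sup>2)) * Re (u ^ n))"
      unfolding fac ..
    also have "\<dots> = h y"
    proof -
      have e: "Re (kern n d (of_real y * \<i>) / of_real (d\<^sup>2 + y\<^sup>2)) =
          (-1) ^ n * (Re (u ^ n) * exp (- (real n * d * y\<^sup>2))) / (d\<^sup>2 + y\<^sup>2)"
        unfolding kern_iy by (cases "even n") (simp_all del: of_real_add of_real_power)
      show ?thesis unfolding h_def e by (cases "even n") (simp_all add: mult.commute)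
    qed
    finally show ?thesis .
  qed
  have h_abs: "h absolutely_integrable_on {0<..}"
    unfolding set_integrable_def
    using h_int by (intro integrable_completion[THEN iffD2] integrable_mult_indicator) auto
  define b where "b = integral {0<..} h"
  have "(\<lambda>y. \<bar>g' y\<bar> * f (g y)) absolutely_integrable_on {0<..}"
    using h_abs by (rule iffD2[OF set_integrable_cong[OF refl refl transform], rotated])
  moreover have "integral {0<..} (\<lambda>y. \<bar>g' y\<bar> * f (g y)) = b"
    unfolding b_def by (rule Henstock_Kurzweil_Integration.integral_cong[OF transform])
  ultimately have "(\<lambda>y. \<bar>g' y\<bar> * f (g y)) absolutely_integrable_on {0<..} \<and>
        integral {0<..} (\<lambda>y. \<bar>g' y\<bar> * f (g y)) = b" ..
  then have f_int: "f absolutely_integrable_on {-1<..<1}" "integral {-1<..<1} f = b"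
    using has_absolute_integral_change_of_variables_1'[of "{0<..}" g g' f b, OF _ der inj] image
    by auto
  \<comment> \<open>Since \<open>f\<close> vanishes at both end points, by division by 0, the interval may be opened.\<close>
  have "(LBINT x:{-1..1}. f x) = (LINT x|lborel. indicator {-1<..<1} x *\<^sub>R f x)"
    unfolding set_lebesgue_integral_def
    by (intro Bochner_Integration.integral_cong) (auto simp: indicator_def f_def)
  also have "\<dots> = (LINT x|lebesgue. indicator {-1<..<1} x *\<^sub>R f x)"
    by (rule integral_completion[symmetric]) (use f_meas in measurable)
  also have "\<dots> = b"
    using set_lebesgue_integral_eq_integral(2)[OF f_int(1)] f_int(2)
    by (simp add: set_lebesgue_integral_def)
  also have "b = (LINT y|lebesgue. indicator {0<..} y *\<^sub>R h y)"
    using set_lebesgue_integral_eq_integral(2)[OF h_abs]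
    by (simp add: set_lebesgue_integral_def b_def)
  also have "\<dots> = (LINT y|lborel. indicator {0<..} y *\<^sub>R h y)"
    by (rule integral_completion) (use h_int in measurable)
  also have "\<dots> = (LINT y|lborel. indicator {0..} y *\<^sub>R h y)"
    by (rule integral_discrete_difference[of "{0}"]) (auto split: split_indicator)
  also have "\<dots> = (LINT y|lborel. (-1) ^ n * (2 * d) *
      Re (indicator {0..} y *\<^sub>R (kern n d (of_real y * \<i>) / of_real (d\<^sup>2 + y\<^sup>2))))"
    by (intro Bochner_Integration.integral_cong) (auto simp: h_def)
  also have "\<dots> = (-1) ^ n * (2 * d) *
      Re (LINT y:{0..}|lborel. kern n d (of_real y * \<i>) / of_real (d\<^sup>2 + y\<^sup>2))"
    unfolding set_lebesgue_integral_def
    by (subst integral_mult_right_zero, subst integral_Re)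
       (rule integrable_mult_indicator[OF _ integrable_kern_imaginary_axis[OF d n]], simp_all)
  finally show ?thesis
    by (simp add: cheb_coeff_def f_def)
qed

section \<open>Moving the line of integration through the saddle point\<close>

lemma has_field_derivative_kern:
  assumes "w \<noteq> of_real d" "w \<noteq> - of_real d"
  shows "(kern n d has_field_derivative
           2 * of_real (real n * d) * (1 / (w\<^sup>2 - (of_real d)\<^sup>2) + w) * kern n d w) (at w)"
proof -
  let ?d = "complex_of_real d"
  define q where "q w = (w - ?d) / (w + ?d)" for w
  have nz: "w + ?d \<noteq> 0" "w - ?d \<noteq> 0" using assms by (auto simp: add_eq_0_iff)
  then have q_nz: "q w \<noteq> 0" by (simp add: q_def)
  have "(q has_field_derivative 2 * ?d / (w + ?d)\<^sup>2) (at w)"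
    unfolding q_def using nz
    by (auto intro!: derivative_eq_intros simp: power2_eq_square)
  moreover have "2 * ?d / (w + ?d)\<^sup>2 = q w * (2 * ?d / (w\<^sup>2 - ?d\<^sup>2))"
  proof -
    have "w\<^sup>2 - ?d\<^sup>2 = (w - ?d) * (w + ?d)" by (simp add: power2_eq_square algebra_simps)
    with nz show ?thesis by (simp add: q_def power2_eq_square)
  qed
  ultimately have q': "(q has_field_derivative q w * (2 * ?d / (w\<^sup>2 - ?d\<^sup>2))) (at w)" by simp
  have pow: "((\<lambda>w. q w ^ n) has_field_derivative of_nat n * (2 * ?d / (w\<^sup>2 - ?d\<^sup>2)) * q w ^ n) (at w)"
  proof (cases n)
    case (Suc m)
    show ?thesis unfolding Suc
      by (rule DERIV_cong[OF DERIV_power[OF q', of "Suc m"]]) (simp add: algebra_simps)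
  qed simp
  have ex: "((\<lambda>w. exp (of_real (real n * d) * w\<^sup>2)) has_field_derivative
          of_real (real n * d) * (2 * w) * exp (of_real (real n * d) * w\<^sup>2)) (at w)"
    by (auto intro!: derivative_eq_intros)
  have "((\<lambda>w. q w ^ n * exp (of_real (real n * d) * w\<^sup>2)) has_field_derivative
          2 * of_real (real n * d) * (1 / (w\<^sup>2 - ?d\<^sup>2) + w) * (q w ^ n * exp (of_real (real n * d) * w\<^sup>2))) (at w)"
    by (rule DERIV_cong[OF DERIV_mult[OF pow ex]]) (simp add: algebra_simps)
  then show ?thesis
    by (simp add: kern_def[abs_def] q_def)
qed

lemma kern_holomorphic:
  assumes "d > 0"
  shows "kern n d holomorphic_on {w. Re w > - d}"
proof -
  have "w + of_real d \<noteq> 0" if "Re w > - d" for w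
    using that by (auto simp: complex_eq_iff)
  then show ?thesis
    unfolding kern_def[abs_def] by (intro holomorphic_intros) auto
qed

lemma integrable_kern_vertical_line:
  assumes d: "d > 0" and n: "n \<ge> 1" and a: "a \<ge> 0"
  shows "set_integrable lborel {0..} (\<lambda>y. (of_real a + of_real y * \<i>) * kern n d (of_real a + of_real y * \<i>))"
proof -
  define c where "c = real n * d"
  have c: "c > 0" using d n by (simp add: c_def)
  have "integrable lborel (\<lambda>y. (1 + a) * (max 1 (6 / c)) ^ 3 * exp (c * a\<^sup>2) * exp (- (c / 2) * y\<^sup>2))"
    using real_gaussian[of "c / 2"] c
    by (intro integrable_mult_right) (simp add: has_bochner_integral_iff)
  then have "integrable lborel (\<lambda>y. (of_real a + of_real y * \<i>) * kern n d (of_real a + of_real y * \<i>))"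
  proof (rule Bochner_Integration.integrable_bound)
    have "continuous_on UNIV (\<lambda>y. (of_real a + of_real y * \<i>) * kern n d (of_real a + of_real y * \<i>))"
      by (intro continuous_on_mult continuous_on_kern_vertical d a) (intro continuous_intros)
    then show "(\<lambda>y. (of_real a + of_real y * \<i>) * kern n d (of_real a + of_real y * \<i>)) \<in> borel_measurable lborel"
      by (simp add: borel_measurable_continuous_onI)
    show "AE y in lborel. norm ((of_real a + of_real y * \<i>) * kern n d (of_real a + of_real y * \<i>))
       \<le> norm ((1 + a) * (max 1 (6 / c)) ^ 3 * exp (c * a\<^sup>2) * exp (- (c / 2) * y\<^sup>2))"
    proof (intro AE_I2)
      fix y :: real
      have ay: "\<bar>y\<bar> \<le> 1 + y\<^sup>2"
        using sum_power2_ge_zero[of "\<bar>y\<bar> - 1/2" 0] by (simp add: power2_eq_square algebra_simps)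
      have "cmod (of_real a + of_real y * \<i>) \<le> a + \<bar>y\<bar>"
        using norm_triangle_ineq[of "of_real a" "of_real y * \<i>"] a by (simp add: norm_mult)
      also have "\<dots> \<le> (1 + a) * (1 + y\<^sup>2)"
      proof -
        have "0 \<le> a * y\<^sup>2" using a by simp
        moreover have "(1 + a) * (1 + y\<^sup>2) = 1 + a + y\<^sup>2 + a * y\<^sup>2" by (simp add: algebra_simps)
        ultimately show ?thesis using ay by linarith
      qed
      also have "\<dots> \<le> (1 + a) * (1 + y\<^sup>2) ^ 3"
        using a by (intro mult_left_mono self_le_power) auto
      finally have "cmod ((of_real a + of_real y * \<i>) * kern n d (of_real a + of_real y * \<i>))
          \<le> (1 + a) * (1 + y\<^sup>2) ^ 3 * exp (c * (a\<^sup>2 - y\<^sup>2))"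
        unfolding norm_mult c_def using norm_kern_le[OF d, of "of_real a + of_real y * \<i>" n] a
        by (intro mult_mono) auto
      also have "\<dots> = (1 + a) * exp (c * a\<^sup>2) * ((1 + y\<^sup>2) ^ 3 * exp (- c * y\<^sup>2))"
        by (simp add: algebra_simps exp_diff exp_minus field_simps)
      also have "\<dots> \<le> (1 + a) * exp (c * a\<^sup>2) * ((max 1 (6 / c)) ^ 3 * exp (- c * y\<^sup>2 / 2))"
        using c a by (intro mult_left_mono cubic_le_exp) auto
      finally show "norm ((of_real a + of_real y * \<i>) * kern n d (of_real a + of_real y * \<i>))
         \<le> norm ((1 + a) * (max 1 (6 / c)) ^ 3 * exp (c * a\<^sup>2) * exp (- (c / 2) * y\<^sup>2))"
        using a by (simp add: mult_ac)
    qed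
  qed
  then show ?thesis
    unfolding set_integrable_def by (intro integrable_mult_indicator) auto
qed

text \<open>Let \<open>P\<close> be a primitive of \<open>w * kern n d w\<close>. By \<open>has_field_derivative_kern\<close>,
\<open>P - kern n d / (2 * n * d)\<close> is a primitive of \<open>kern n d w / (d\<^sup>2 - w\<^sup>2)\<close> on the imaginary axis. At height
\<open>R\<close> the values of \<open>P\<close> on the two lines differ by a quantity that tends to 0, and so does \<open>kern\<close> itself; hence the two
integrals differ only by boundary terms on the real axis. There \<open>kern\<close> is real, and after division
by the imaginary unit that comes from \<open>dw = i * dy\<close> these terms do not affect the real part.\<close>

lemma kern_integral_shift:
  assumes d: "d > 0" and n: "n \<ge> 1" and a: "a \<ge> 0"
  shows "Re (LINT y:{0..}|lborel. kern n d (of_real y * \<i>) / of_real (d\<^sup>2 + y\<^sup>2)) =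
         Re (LINT y:{0..}|lborel. (of_real a + of_real y * \<i>) * kern n d (of_real a + of_real y * \<i>))"
proof -
  define c where "c = real n * d"
  have c: "c > 0" using d n by (simp add: c_def)
  define D where "D = {w. Re w > - d}"
  have hol: "(\<lambda>w. w * kern n d w) holomorphic_on D"
    unfolding D_def by (intro holomorphic_intros kern_holomorphic d)
  have "open D" "convex D"
    unfolding D_def by (simp_all add: open_halfspace_Re_gt convex_halfspace_Re_gt)
  from primitive_on_convex[OF hol this]
  obtain P where "\<forall>w\<in>D. (P has_field_derivative w * kern n d w) (at w)" ..
  then have P: "(P has_field_derivative w * kern n d w) (at w)" if "Re w \<ge> 0" for w
    using that d by (auto simp: D_def)
  define Q where "Q w = P w - kern n d w / (2 * of_real c)" for w
  have Q: "(Q has_field_derivative kern n d w / ((of_real d)\<^sup>2 - w\<^sup>2)) (at w)"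
    if w: "Re w = 0" for w
  proof -
    have nz: "w \<noteq> of_real d" "w \<noteq> - of_real d" using w d by auto
    have "(w - of_real d) * (w + of_real d) \<noteq> 0" using nz by (auto simp: add_eq_0_iff)
    then have nz2: "w\<^sup>2 - (of_real d)\<^sup>2 \<noteq> 0" by (simp add: power2_eq_square algebra_simps)
    have "(Q has_field_derivative w * kern n d w -
       2 * of_real c * (1 / (w\<^sup>2 - (of_real d)\<^sup>2) + w) * kern n d w / (2 * of_real c)) (at w)"
      unfolding Q_def c_def
      by (intro DERIV_diff DERIV_cdivide P has_field_derivative_kern nz) (simp add: w)
    moreover have "2 * of_real c * X * k / (2 * of_real c) = X * k" for X k :: complex
      using c by simp
    moreover have "k / ((of_real d)\<^sup>2 - w\<^sup>2) = - (k / (w\<^sup>2 - (of_real d)\<^sup>2))" for k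
      by (metis minus_diff_eq minus_divide_right)
    ultimately show ?thesis by (simp add: distrib_right)
  qed
  define I1 where "I1 = (LINT y:{0..}|lborel. kern n d (of_real y * \<i>) / of_real (d\<^sup>2 + y\<^sup>2))"
  define I2 where "I2 = (LINT y:{0..}|lborel. (of_real a + of_real y * \<i>) * kern n d (of_real a + of_real y * \<i>))"
  have eq1: "kern n d (0 + of_real y * \<i>) / ((of_real d)\<^sup>2 - (0 + of_real y * \<i>)\<^sup>2) =
      kern n d (of_real y * \<i>) / of_real (d\<^sup>2 + y\<^sup>2)" for y
    by (simp add: power_mult_distrib)
  have "set_integrable lborel {0..} (\<lambda>y. kern n d (of_real y * \<i>) / of_real (d\<^sup>2 + y\<^sup>2))"
    unfolding set_integrable_def
    by (intro integrable_mult_indicator integrable_kern_imaginary_axis d n) auto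
  then have lim1: "((\<lambda>R. Q (0 + of_real R * \<i>) - Q 0) \<longlongrightarrow> \<i> * I1) at_top"
    unfolding I1_def eq1[symmetric]
    by (intro ray_integral_limit Q) auto
  have lim2: "((\<lambda>R. P (of_real a + of_real R * \<i>) - P (of_real a)) \<longlongrightarrow> \<i> * I2) at_top"
    unfolding I2_def using integrable_kern_vertical_line[OF d n a]
    by (intro ray_integral_limit P) (use a in auto)
  have lim3: "((\<lambda>R. P (of_real a + of_real R * \<i>) - P (0 + of_real R * \<i>)) \<longlongrightarrow> 0) at_top"
  proof (rule Lim_null_comparison)
    \<comment> \<open>The horizontal segment has length \<open>a\<close>, and on it the integrand is at most
       \<open>(a + R) * exp (c * (a\<^sup>2 - R\<^sup>2))\<close>.\<close>
    show "((\<lambda>R. (a + R) * exp (c * (a\<^sup>2 - R\<^sup>2)) * a) \<longlongrightarrow> 0) at_top"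
      using c by real_asymp
    show "\<forall>\<^sub>F R in at_top. norm (P (of_real a + of_real R * \<i>) - P (0 + of_real R * \<i>))
            \<le> (a + R) * exp (c * (a\<^sup>2 - R\<^sup>2)) * a"
      using eventually_ge_at_top[of 0]
    proof eventually_elim
      fix R :: real assume R: "0 \<le> R"
      define Seg where "Seg = closed_segment (of_real a + of_real R * \<i>) (0 + of_real R * \<i>)"
      have "norm (P (of_real a + of_real R * \<i>) - P (0 + of_real R * \<i>))
              \<le> (a + R) * exp (c * (a\<^sup>2 - R\<^sup>2)) * norm ((of_real a + of_real R * \<i>) - (0 + of_real R * \<i>))"
      proof (rule field_differentiable_bound[of Seg P "\<lambda>w. w * kern n d w"])
        fix w assume "w \<in> Seg"
        then obtain u where u: "0 \<le> u" "u \<le> 1"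
          and w: "w = (1 - u) *\<^sub>R (of_real a + of_real R * \<i>) + u *\<^sub>R (0 + of_real R * \<i>)"
          by (auto simp: Seg_def closed_segment_def)
        have Re_w: "Re w = (1 - u) * a" by (simp add: w)
        have Im_w: "Im w = R" by (simp add: w algebra_simps)
        have bds: "0 \<le> Re w" "Re w \<le> a"
          using u a by (auto simp: Re_w mult_left_le_one_le)
        show "(P has_field_derivative w * kern n d w) (at w within Seg)"
          using P[OF bds(1)] by (rule has_field_derivative_at_within)
        have "cmod w \<le> a + R"
          using cmod_le[of w] bds R by (simp add: Im_w)
        moreover have "cmod (kern n d w) \<le> exp (c * (a\<^sup>2 - R\<^sup>2))"
        proof -
          have "(Re w)\<^sup>2 \<le> a\<^sup>2" using bds by (intro power_mono)
          then have "c * ((Re w)\<^sup>2 - (Im w)\<^sup>2) \<le> c * (a\<^sup>2 - R\<^sup>2)"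
            using c by (intro mult_left_mono) (auto simp: Im_w)
          with norm_kern_le[OF d bds(1), of n] show ?thesis
            by (simp add: c_def) (meson exp_le_cancel_iff order_trans)
        qed
        ultimately show "norm (w * kern n d w) \<le> (a + R) * exp (c * (a\<^sup>2 - R\<^sup>2))"
          unfolding norm_mult using a R by (intro mult_mono) auto
      qed (auto simp: Seg_def)
      then show "norm (P (of_real a + of_real R * \<i>) - P (0 + of_real R * \<i>))
            \<le> (a + R) * exp (c * (a\<^sup>2 - R\<^sup>2)) * a"
        using a by simp
    qed
  qed
  have lim4: "((\<lambda>R. kern n d (0 + of_real R * \<i>) / (2 * of_real c)) \<longlongrightarrow> 0) at_top"
  proof (rule Lim_null_comparison)
    show "((\<lambda>R. exp (- c * R\<^sup>2) / (2 * c)) \<longlongrightarrow> 0) at_top"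
      using c by real_asymp
    show "\<forall>\<^sub>F R in at_top. norm (kern n d (0 + of_real R * \<i>) / (2 * of_real c)) \<le> exp (- c * R\<^sup>2) / (2 * c)"
    proof (intro always_eventually allI)
      fix R :: real
      show "norm (kern n d (0 + of_real R * \<i>) / (2 * of_real c)) \<le> exp (- c * R\<^sup>2) / (2 * c)"
        using norm_kern_le[OF d, of "0 + of_real R * \<i>" n] c d
        by (simp add: norm_divide norm_mult c_def divide_right_mono)
    qed
  qed
  have "((\<lambda>R. (Q (0 + of_real R * \<i>) - Q 0) - (P (of_real a + of_real R * \<i>) - P (of_real a))
           + (P (of_real a + of_real R * \<i>) - P (0 + of_real R * \<i>))
           + kern n d (0 + of_real R * \<i>) / (2 * of_real c)) \<longlongrightarrow> \<i> * I1 - \<i> * I2 + 0 + 0) at_top"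
    by (intro tendsto_add tendsto_diff lim1 lim2 lim3 lim4)
  moreover have "(Q (0 + of_real R * \<i>) - Q 0) - (P (of_real a + of_real R * \<i>) - P (of_real a))
           + (P (of_real a + of_real R * \<i>) - P (0 + of_real R * \<i>))
           + kern n d (0 + of_real R * \<i>) / (2 * of_real c)
        = P (of_real a) - P (of_real 0) + kern n d (of_real 0) / (2 * of_real c)" for R
    by (simp add: Q_def)
  ultimately have "((\<lambda>R::real. P (of_real a) - P (of_real 0) + kern n d (of_real 0) / (2 * of_real c))
        \<longlongrightarrow> \<i> * (I1 - I2)) at_top"
    by (simp only: right_diff_distrib add_0_right)
  then have diff: "P (of_real a) - P (of_real 0) + kern n d (of_real 0) / (2 * of_real c) = \<i> * (I1 - I2)"
    using tendsto_unique[OF _ tendsto_const] by (metis trivial_limit_at_top_linorder)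
  have kern_real: "kern n d (of_real x) = of_real (((x - d) / (x + d)) ^ n * exp (real n * d * x\<^sup>2))" for x
    by (simp add: kern_def exp_of_real[symmetric])
  have "Im (P (of_real a)) = Im (P (of_real 0))"
  proof -
    have "((\<lambda>t. Im (P (of_real t))) has_field_derivative 0) (at t within {0..})" if t: "t \<in> {0..}" for t :: real
    proof -
      have "((\<lambda>t. P (of_real t)) has_vector_derivative of_real t * kern n d (of_real t)) (at t within {0..})"
        by (rule has_vector_derivative_at_within, rule has_vector_derivative_real_field, rule P) (use t in auto)
      then have "((\<lambda>t. Im (P (of_real t))) has_vector_derivative Im (of_real t * kern n d (of_real t))) (at t within {0..})"
        by (rule bounded_linear.has_vector_derivative[OF bounded_linear_Im])
      moreover have "Im (of_real t * kern n d (of_real t)) = 0"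
        unfolding kern_real by simp
      ultimately show ?thesis
        by (simp only: has_real_derivative_iff_has_vector_derivative)
    qed
    then obtain k where k: "\<And>t. t \<in> {0..} \<Longrightarrow> Im (P (of_real t)) = k"
      using has_field_derivative_zero_constant[of "{0::real..}" "\<lambda>t. Im (P (of_real t))"] by auto
    show ?thesis using k[of a] k[of 0] a by simp
  qed
  then have "Im (P (of_real a) - P (of_real 0) + kern n d (of_real 0) / (2 * of_real c)) = 0"
    unfolding kern_real by (simp flip: of_real_mult of_real_divide)
  then have "Re (I1 - I2) = 0"
    unfolding diff by simp
  then show ?thesis by (simp add: I1_def I2_def)
qed

text \<open>Let \<open>A = (a - d)\<^sup>2\<close>, \<open>B = (a + d)\<^sup>2\<close>, \<open>s = y\<^sup>2\<close> and \<open>t = b\<^sup>2\<close>. The squared modulus of the quotient in \<open>kern\<close> is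
\<open>(A + s) / (B + s)\<close>, and its ratio \<open>r\<close> to the value at the saddle satisfies \<open>r \<le> exp (r - 1)\<close>. The saddle
point equation in the form \<open>(A + t) * (B + t) = 2 * a\<close> turns \<open>r - 1\<close> into
\<open>2 * d * (s - t) * (B + t) / (B + s)\<close>; together with the factor \<open>exp (2 * n * d * (t - s))\<close> of the
Gaussian part, exactly \<open>- 2 * n * d * (s - t)\<^sup>2 / (B + s)\<close> is left. No logarithm is involved, so the bound also
holds where the line meets the zero \<open>d\<close> of \<open>kern\<close>.\<close>

lemma norm_kern_vertical_line_le:
  assumes d: "d > 0" and a: "a > 0"
    and saddle: "((a - d)\<^sup>2 + b\<^sup>2) * ((a + d)\<^sup>2 + b\<^sup>2) = 2 * a"
  shows "cmod (kern n d (of_real a + of_real y * \<i>)) \<le>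
    cmod (kern n d (of_real a + of_real b * \<i>)) *
      exp (- (real n * d) * ((y\<^sup>2 - b\<^sup>2)\<^sup>2 / ((a + d)\<^sup>2 + y\<^sup>2)))"
proof (rule power2_le_imp_le)
  define A B where "A = (a - d)\<^sup>2" and "B = (a + d)\<^sup>2"
  define s t where "s = y\<^sup>2" and "t = b\<^sup>2"
  have nonneg: "A \<ge> 0" "s \<ge> 0" "t \<ge> 0" and B: "B > 0"
    using a d by (auto simp: A_def B_def s_def t_def)
  have AB: "(A + t) * (B + t) = 2 * a" using saddle by (simp add: A_def B_def t_def)
  have At: "A + t > 0"
    using AB a nonneg by (cases "A + t = 0") auto
  have norm_sq: "(cmod (kern n d (of_real a + of_real x * \<i>)))\<^sup>2 =
      ((A + x\<^sup>2) / (B + x\<^sup>2)) ^ n * exp (2 * (real n * d) * (a\<^sup>2 - x\<^sup>2))" for x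
  proof -
    have m: "(cmod (of_real a + of_real x * \<i> - of_real d))\<^sup>2 = A + x\<^sup>2"
         "(cmod (of_real a + of_real x * \<i> + of_real d))\<^sup>2 = B + x\<^sup>2"
      by (simp_all add: cmod_power2 A_def B_def)
    have "(cmod (kern n d (of_real a + of_real x * \<i>)))\<^sup>2 =
      ((cmod (of_real a + of_real x * \<i> - of_real d))\<^sup>2 / (cmod (of_real a + of_real x * \<i> + of_real d))\<^sup>2) ^ n
        * (exp (real n * d * (a\<^sup>2 - x\<^sup>2)))\<^sup>2"
      by (simp add: kern_def norm_mult norm_power norm_divide power_mult_distrib power_divide
            power2_eq_square power_mult[symmetric] mult.commute)
    then show ?thesis
      unfolding m by (simp add: power2_eq_square exp_add[symmetric] algebra_simps)
  qed
  define r where "r = (A + s) * (B + t) / ((B + s) * (A + t))"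
  have r1: "r - 1 = 2 * d * ((s - t) * (B + t) / (B + s))"
  proof -
    have "r - 1 = ((A + s) * (B + t) - (B + s) * (A + t)) / ((B + s) * (A + t))"
      using B nonneg At by (simp add: r_def diff_divide_distrib)
    also have "(A + s) * (B + t) - (B + s) * (A + t) = (B - A) * (s - t)"
      by (simp add: algebra_simps)
    also have "B - A = 2 * d * ((A + t) * (B + t))"
      unfolding AB by (simp add: A_def B_def power2_eq_square algebra_simps)
    finally show ?thesis using At by simp
  qed
  have "(A + s) / (B + s) = (A + t) / (B + t) * r"
    using At B nonneg by (simp add: r_def)
  also have "\<dots> \<le> (A + t) / (B + t) * exp (r - 1)"
    using At B nonneg exp_ge_add_one_self[of "r - 1"] by (intro mult_left_mono) auto
  finally have "((A + s) / (B + s)) ^ n \<le> ((A + t) / (B + t) * exp (r - 1)) ^ n"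
    using B nonneg by (intro power_mono) auto
  also have "\<dots> = ((A + t) / (B + t)) ^ n * exp (real n * (r - 1))"
    by (simp only: power_mult_distrib exp_of_nat_mult)
  finally have "(cmod (kern n d (of_real a + of_real y * \<i>)))\<^sup>2 \<le>
      ((A + t) / (B + t)) ^ n * exp (real n * (r - 1)) * exp (2 * (real n * d) * (a\<^sup>2 - s))"
    unfolding norm_sq s_def[symmetric] by (intro mult_right_mono) auto
  also have "\<dots> = ((A + t) / (B + t)) ^ n * exp (real n * (r - 1) + 2 * (real n * d) * (a\<^sup>2 - s))"
    by (simp add: exp_add mult.assoc)
  also have "real n * (r - 1) + 2 * (real n * d) * (a\<^sup>2 - s) =
      2 * (real n * d) * (a\<^sup>2 - t) + 2 * (- (real n * d) * ((s - t)\<^sup>2 / (B + s)))"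
  proof -
    have "real n * (2 * d * X) + 2 * (real n * d) * (a\<^sup>2 - s) =
        2 * (real n * d) * (a\<^sup>2 - t) + 2 * (- (real n * d) * Y)" if "X = (s - t) - Y" for X Y
      by (simp add: that algebra_simps)
    moreover have "(s - t) * (B + t) / (B + s) = (s - t) - (s - t)\<^sup>2 / (B + s)"
      using B nonneg by (simp add: field_simps power2_eq_square)
    ultimately show ?thesis unfolding r1 by blast
  qed
  also have "((A + t) / (B + t)) ^ n * exp (2 * (real n * d) * (a\<^sup>2 - t) + 2 * (- (real n * d) * ((s - t)\<^sup>2 / (B + s)))) =
      (cmod (kern n d (of_real a + of_real b * \<i>)) *
      exp (- (real n * d) * ((y\<^sup>2 - b\<^sup>2)\<^sup>2 / ((a + d)\<^sup>2 + y\<^sup>2))))\<^sup>2"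
    unfolding power_mult_distrib norm_sq s_def[symmetric] t_def[symmetric] B_def[symmetric]
    by (simp only: exp_add exp_double mult.assoc)
  finally show "(cmod (kern n d (of_real a + of_real y * \<i>)))\<^sup>2 \<le>
      (cmod (kern n d (of_real a + of_real b * \<i>)) *
      exp (- (real n * d) * ((y\<^sup>2 - b\<^sup>2)\<^sup>2 / ((a + d)\<^sup>2 + y\<^sup>2))))\<^sup>2" .
qed auto

section \<open>The scaled saddle point and the local expansion of the phase\<close>

text \<open>The real and imaginary parts of \<open>w ^ 3 - d\<^sup>2 * w + 1 = 0\<close> for \<open>w = a + b * i\<close> with \<open>b \<noteq> 0\<close>, the
variable \<open>b\<close> being eliminated from the real part.\<close>

definition scaled_saddle :: "real \<Rightarrow> real \<Rightarrow> real \<Rightarrow> bool" where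
  "scaled_saddle d a b \<longleftrightarrow>
     d > 0 \<and> a > 0 \<and> b > 0 \<and> b\<^sup>2 = 3 * a\<^sup>2 - d\<^sup>2 \<and> 8 * a ^ 3 - 2 * a * d\<^sup>2 = 1"

text \<open>The bounds confine the saddle to a compact set that does not depend on \<open>d\<close>. The last equation says
that the real part of the second derivative of the phase at the saddle is \<open>16 * a * b\<^sup>2\<close>, so the
Gaussian degenerates only if the saddle approaches the real axis.\<close>

lemma scaled_saddle_bounds:
  assumes "scaled_saddle d a b"
  shows "1 / 2 \<le> a" "a \<le> 1" "b \<le> 1" "d \<le> 2"
    and "2 * a * (a\<^sup>2 + b\<^sup>2) = 1"
    and "((a - d)\<^sup>2 + b\<^sup>2) * ((a + d)\<^sup>2 + b\<^sup>2) = 2 * a"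
    and "6 - 4 * d\<^sup>2 * a = 16 * a * b\<^sup>2"
proof -
  have d: "d > 0" and a: "a > 0" and b: "b > 0"
    and b2: "b\<^sup>2 = 3 * a\<^sup>2 - d\<^sup>2" and cub: "8 * a ^ 3 - 2 * a * d\<^sup>2 = 1"
    using assms by (auto simp: scaled_saddle_def)
  have "2 * a * (4 * a\<^sup>2 - d\<^sup>2) = 1"
    using cub by (simp add: power2_eq_square power3_eq_cube algebra_simps)
  then show prod: "2 * a * (a\<^sup>2 + b\<^sup>2) = 1" by (simp add: b2 algebra_simps)
  show a_half: "1 / 2 \<le> a"
  proof (rule ccontr)
    assume "\<not> 1 / 2 \<le> a"
    then have "a ^ 3 < (1 / 2) ^ 3" using a by (intro power_strict_mono) auto
    moreover have "0 \<le> a * d\<^sup>2" using a by simp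
    ultimately show False using cub by (simp add: power3_eq_cube)
  qed
  have cub2: "2 * a ^ 3 + 2 * (a * b\<^sup>2) = 1"
    using prod by (simp add: power2_eq_square power3_eq_cube algebra_simps)
  have ab2: "a * b\<^sup>2 > 0" using a b by simp
  show a_one: "a \<le> 1"
  proof (rule ccontr)
    assume "\<not> a \<le> 1"
    then have "1 ^ 3 < a ^ 3" by (intro power_strict_mono) auto
    with cub2 ab2 show False by simp
  qed
  have "b\<^sup>2 \<le> 1\<^sup>2"
  proof -
    have "1 / 2 * b\<^sup>2 \<le> a * b\<^sup>2" using a_half by (intro mult_right_mono) auto
    moreover have "a ^ 3 > 0" using a by simp
    ultimately have "b\<^sup>2 \<le> 1" using cub2 by linarith
    then show ?thesis by simp
  qed
  then show "b \<le> 1" using power2_le_imp_le[of b 1] by simp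
  have "a\<^sup>2 \<le> 1" using a a_one by (simp add: power_le_one)
  then have "d\<^sup>2 \<le> 2\<^sup>2" using b2 zero_le_power2[of b] by simp
  then show "d \<le> 2" using power2_le_imp_le[of d 2] by simp
  have m: "(a - d)\<^sup>2 + b\<^sup>2 = 2 * a * (2 * a - d)" "(a + d)\<^sup>2 + b\<^sup>2 = 2 * a * (2 * a + d)"
  proof -
    have "(a - d)\<^sup>2 + b\<^sup>2 = 4 * a\<^sup>2 - 2 * (a * d)" "(a + d)\<^sup>2 + b\<^sup>2 = 4 * a\<^sup>2 + 2 * (a * d)"
      unfolding b2 by (simp_all add: power2_eq_square algebra_simps)
    moreover have "2 * a * (2 * a - d) = 4 * a\<^sup>2 - 2 * (a * d)" "2 * a * (2 * a + d) = 4 * a\<^sup>2 + 2 * (a * d)"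
      by (simp_all add: power2_eq_square algebra_simps)
    ultimately show "(a - d)\<^sup>2 + b\<^sup>2 = 2 * a * (2 * a - d)" "(a + d)\<^sup>2 + b\<^sup>2 = 2 * a * (2 * a + d)"
      by simp_all
  qed
  have "((a - d)\<^sup>2 + b\<^sup>2) * ((a + d)\<^sup>2 + b\<^sup>2) = 2 * a * (8 * a ^ 3 - 2 * a * d\<^sup>2)"
    unfolding m by (simp add: power2_eq_square power3_eq_cube algebra_simps)
  then show "((a - d)\<^sup>2 + b\<^sup>2) * ((a + d)\<^sup>2 + b\<^sup>2) = 2 * a" unfolding cub by simp
  have "a * b\<^sup>2 * 16 = 8 - 16 * a ^ 3" using cub2 by linarith
  moreover have "d\<^sup>2 * a = a * d\<^sup>2" "16 * a * b\<^sup>2 = a * b\<^sup>2 * 16" "2 * a * d\<^sup>2 = 2 * (a * d\<^sup>2)"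
    "4 * d\<^sup>2 * a = 4 * (d\<^sup>2 * a)"
    by simp_all
  ultimately show "6 - 4 * d\<^sup>2 * a = 16 * a * b\<^sup>2" using cub by linarith
qed

lemma scaled_saddle_cubic:
  assumes "scaled_saddle d a b"
  defines "w0 \<equiv> Complex a b"
  shows "w0 ^ 3 - of_real (d\<^sup>2) * w0 + 1 = 0"
proof -
  have b2: "b * b = 3 * (a * a) - d * d" and cub: "8 * (a * a * a) - 2 * a * (d * d) = 1"
    using assms by (auto simp: scaled_saddle_def power2_eq_square power3_eq_cube)
  have "Re (w0 ^ 3 - of_real (d\<^sup>2) * w0 + 1) = a * a * a - 3 * a * (b * b) - d * d * a + 1"
    by (simp add: w0_def power2_eq_square power3_eq_cube algebra_simps)
  also have "\<dots> = 0" unfolding b2 using cub by (simp add: algebra_simps)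
  finally have re: "Re (w0 ^ 3 - of_real (d\<^sup>2) * w0 + 1) = 0" .
  have "Im (w0 ^ 3 - of_real (d\<^sup>2) * w0 + 1) = b * (3 * (a * a) - b * b - d * d)"
    by (simp add: w0_def power2_eq_square power3_eq_cube algebra_simps)
  also have "\<dots> = 0" unfolding b2 by simp
  finally show ?thesis using re by (simp add: complex_eq_iff)
qed

lemma norm_scaled_saddle:
  assumes "scaled_saddle d a b"
  shows "cmod (Complex a b) \<le> 1" "cmod (1 / Complex a b) \<le> 2"
proof -
  note bds = scaled_saddle_bounds[OF assms]
  have n2: "(cmod (Complex a b))\<^sup>2 = a\<^sup>2 + b\<^sup>2" by (simp add: cmod_power2)
  have "a > 0" using assms by (simp add: scaled_saddle_def)
  then have pos: "a\<^sup>2 + b\<^sup>2 > 0" by (simp add: add_pos_nonneg)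
  have "1 * (a\<^sup>2 + b\<^sup>2) \<le> 2 * a * (a\<^sup>2 + b\<^sup>2)" using bds(1) pos by (intro mult_right_mono) auto
  with bds(5) n2 have "(cmod (Complex a b))\<^sup>2 \<le> 1\<^sup>2" by simp
  then show "cmod (Complex a b) \<le> 1" by (rule power2_le_imp_le) simp
  have "2 * a * (a\<^sup>2 + b\<^sup>2) \<le> 2 * (a\<^sup>2 + b\<^sup>2)" using bds(2) pos by (intro mult_right_mono) auto
  with bds(5) n2 have "(1 / 2)\<^sup>2 \<le> (cmod (Complex a b))\<^sup>2" by (simp add: power2_eq_square)
  then have "1 / 2 \<le> cmod (Complex a b)" by (rule power2_le_imp_le) simp
  then show "cmod (1 / Complex a b) \<le> 2" by (simp add: norm_divide divide_le_eq)
qed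

text \<open>The left-hand side is the derivative \<open>2 / (w\<^sup>2 - c) + 2 * w\<close> of the phase at \<open>w = w0 + u\<close>, minus its
Taylor polynomial of degree 2 at the saddle. The exact remainder comes from the geometric series of
\<open>1 / D\<close> in powers of \<open>D - D0\<close>, where the saddle point equation gives \<open>1 / D0 = - w0\<close>.\<close>

lemma phase_derivative_expansion:
  fixes w0 u D :: complex
  assumes D0: "(w0\<^sup>2 - c) * w0 = -1" and D: "D = (w0 + u)\<^sup>2 - c" "D \<noteq> 0"
  shows "2 / D + 2 * (w0 + u) - (2 - 4 * w0 ^ 3) * u - (- 2 * w0\<^sup>2 - 8 * w0 ^ 5) * u\<^sup>2
     = u ^ 3 * (- 8 * w0 ^ 4 - 2 * w0 ^ 3 * u + 2 * w0 ^ 3 * (2 * w0 + u) ^ 3 / D)"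
proof -
  define e where "e = (2 * w0 + u) * u"
  have wD: "w0 * D = -1 + w0 * e"
    using D0 unfolding D e_def by (simp add: power2_eq_square algebra_simps)
  have "(2 / D) * D = (2 * w0 ^ 3 * e ^ 3 / D - 2 * w0 - 2 * w0\<^sup>2 * e - 2 * w0 ^ 3 * e\<^sup>2) * D"
  proof -
    have "(2 * w0 ^ 3 * e ^ 3 / D - 2 * w0 - 2 * w0\<^sup>2 * e - 2 * w0 ^ 3 * e\<^sup>2) * D
        = 2 * w0 ^ 3 * e ^ 3 - 2 * (w0 * D) * (1 + w0 * e + w0\<^sup>2 * e\<^sup>2)"
      using D(2) by (simp add: algebra_simps power2_eq_square power3_eq_cube)
    also have "\<dots> = 2" unfolding wD by (simp add: algebra_simps power2_eq_square power3_eq_cube)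
    finally show ?thesis using D(2) by simp
  qed
  then have "2 / D = 2 * w0 ^ 3 * e ^ 3 / D - 2 * w0 - 2 * w0\<^sup>2 * e - 2 * w0 ^ 3 * e\<^sup>2"
    using D(2) by (metis mult_right_cancel)
  moreover have "2 * w0 ^ 3 * e ^ 3 / D = u ^ 3 * (2 * w0 ^ 3 * (2 * w0 + u) ^ 3 / D)"
    by (simp add: e_def power_mult_distrib)
  moreover have "- 2 * w0\<^sup>2 * e - 2 * w0 ^ 3 * e\<^sup>2 + 2 * u - (2 - 4 * w0 ^ 3) * u - (- 2 * w0\<^sup>2 - 8 * w0 ^ 5) * u\<^sup>2
      = u ^ 3 * (- 8 * w0 ^ 4 - 2 * w0 ^ 3 * u)"
    unfolding e_def by (simp add: algebra_simps eval_nat_numeral)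
  ultimately show ?thesis by (simp add: algebra_simps)
qed

text \<open>The remainder of \<open>phase_derivative_expansion\<close> is at most \<open>226 / b\<^sup>2 * \<bar>u\<bar> ^ 3\<close> on the segment, because
\<open>\<bar>w0\<bar> \<le> 1\<close>, \<open>\<bar>u\<bar> \<le> 1\<close> and both factors of \<open>D = w\<^sup>2 - d\<^sup>2\<close> have imaginary part at least \<open>b / 2\<close>; integration
along the segment yields the fourth order bound. In the upper half-plane the quotient in \<open>kern\<close> stays
off the cut of \<open>Ln\<close>, so there \<open>kern\<close> is the exponential of a holomorphic phase.\<close>

lemma kern_local_expansion:
  fixes n :: nat
  assumes sad: "scaled_saddle d a b" and v: "\<bar>v\<bar> \<le> b / 2"
  defines "w0 \<equiv> Complex a b"
  defines "\<tau> \<equiv> \<i> * (2 * w0\<^sup>2 + 8 * w0 ^ 5) / 3"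
  obtains R where "cmod R \<le> 226 / b\<^sup>2 * v ^ 4"
    and "kern n d (w0 + of_real v * \<i>) = kern n d w0 *
      exp (of_real (real n * d) * (- (2 - 4 * w0 ^ 3) / 2 * of_real (v\<^sup>2) + \<tau> * of_real v ^ 3 + R))"
proof -
  have d: "d > 0" and a: "a > 0" and b: "b > 0" using sad by (auto simp: scaled_saddle_def)
  have b1: "b \<le> 1" by (rule scaled_saddle_bounds[OF sad])
  have w0_le: "cmod w0 \<le> 1" using norm_scaled_saddle[OF sad] by (simp add: w0_def)
  define c where "c = complex_of_real (d\<^sup>2)"
  define \<kappa> where "\<kappa> = 2 - 4 * w0 ^ 3"
  define c2 where "c2 = - 2 * w0\<^sup>2 - 8 * w0 ^ 5"
  define M where "M = 226 / b\<^sup>2"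
  have D0: "(w0\<^sup>2 - c) * w0 = -1"
    using scaled_saddle_cubic[OF sad] unfolding w0_def[symmetric] c_def
    by (simp add: algebra_simps power2_eq_square power3_eq_cube eq_neg_iff_add_eq_0)
  define L where "L w = Ln ((w - of_real d) / (w + of_real d))" for w
  define \<phi> where "\<phi> w = L w / of_real d + w\<^sup>2" for w
  define h where "h u = \<phi> (w0 + u) - \<phi> w0 - \<kappa> / 2 * u\<^sup>2 - c2 / 3 * u ^ 3" for u
  have upper: "Im ((w - of_real d) / (w + of_real d)) > 0" if "Im w > 0" for w
  proof -
    have "Im ((w - of_real d) / (w + of_real d)) = 2 * d * Im w / ((Re w + d)\<^sup>2 + (Im w)\<^sup>2)"
      by (simp add: Im_divide algebra_simps)
    also have "\<dots> > 0" using d that by (intro divide_pos_pos add_nonneg_pos) auto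
    finally show ?thesis .
  qed
  have kern_eq: "kern n d w = exp (of_real (real n * d) * \<phi> w)" if w: "Im w > 0" for w
  proof -
    have nz: "(w - of_real d) / (w + of_real d) \<noteq> 0" using upper[OF w] by force
    have "of_real (real n * d) * \<phi> w = of_nat n * L w + of_real (real n * d) * w\<^sup>2"
      using d by (simp add: \<phi>_def algebra_simps)
    moreover have "exp (of_nat n * L w) = ((w - of_real d) / (w + of_real d)) ^ n"
      unfolding exp_of_nat_mult L_def exp_Ln[OF nz] ..
    ultimately show ?thesis by (simp add: kern_def exp_add)
  qed
  have \<phi>': "(\<phi> has_field_derivative 2 / (w\<^sup>2 - c) + 2 * w) (at w)" if w: "Im w > 0" for w
  proof -
    have nz: "w + of_real d \<noteq> 0" "w - of_real d \<noteq> 0" using w by (auto simp: complex_eq_iff)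
    define q where "q = (w - of_real d) / (w + of_real d)"
    have q: "q \<noteq> 0" "q \<notin> \<real>\<^sub>\<le>\<^sub>0"
      using upper[OF w] by (auto simp: q_def complex_nonpos_Reals_iff)
    have "((\<lambda>w. (w - of_real d) / (w + of_real d)) has_field_derivative 2 * of_real d / (w + of_real d)\<^sup>2) (at w)"
      using nz by (auto intro!: derivative_eq_intros simp: power2_eq_square)
    from DERIV_chain2[OF has_field_derivative_Ln[OF q(2)[unfolded q_def]] this]
    have "(L has_field_derivative inverse q * (2 * of_real d / (w + of_real d)\<^sup>2)) (at w)"
      unfolding L_def[abs_def] q_def .
    moreover have "inverse q * (2 * of_real d / (w + of_real d)\<^sup>2) = 2 * of_real d / (w\<^sup>2 - c)"
    proof -
      have "w\<^sup>2 - c = (w - of_real d) * (w + of_real d)" by (simp add: c_def power2_eq_square algebra_simps)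
      with nz show ?thesis by (simp add: q_def power2_eq_square)
    qed
    ultimately have "(L has_field_derivative 2 * of_real d / (w\<^sup>2 - c)) (at w)" by simp
    then have "((\<lambda>w. L w / of_real d + w\<^sup>2) has_field_derivative
        2 * of_real d / (w\<^sup>2 - c) / of_real d + 2 * w) (at w)"
      by (intro DERIV_add DERIV_cdivide) (auto intro!: derivative_eq_intros)
    then show ?thesis using d by (simp add: \<phi>_def[abs_def])
  qed
  define r where "r = \<bar>v\<bar>"
  have r: "0 \<le> r" "r \<le> b / 2" "r \<le> 1" using v b1 by (auto simp: r_def)
  define Seg where "Seg = closed_segment 0 (of_real v * \<i>)"
  have "norm (h (of_real v * \<i>) - h 0) \<le> M * r ^ 3 * norm (of_real v * \<i> - 0)"
  proof (rule field_differentiable_bound[of Seg h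
        "\<lambda>u. 2 / ((w0 + u)\<^sup>2 - c) + 2 * (w0 + u) - \<kappa> * u - c2 * u\<^sup>2"])
    fix u assume "u \<in> Seg"
    then obtain t where t: "0 \<le> t" "t \<le> 1" and u: "u = of_real (t * v) * \<i>"
      by (auto simp: Seg_def closed_segment_def scaleR_conv_of_real mult.assoc)
    have "\<bar>t * v\<bar> \<le> r"
      using t by (simp add: abs_mult r_def mult_left_le_one_le)
    then have u_le: "cmod u \<le> r" by (simp add: u norm_mult)
    have Im_w: "Im (w0 + u) \<ge> b / 2"
      using \<open>\<bar>t * v\<bar> \<le> r\<close> r by (simp add: u w0_def abs_le_iff)
    then have pos: "Im (w0 + u) > 0" using b by simp
    have "((\<lambda>u. \<phi> (w0 + u)) has_field_derivative (2 / ((w0 + u)\<^sup>2 - c) + 2 * (w0 + u)) * 1) (at u)"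
      by (rule DERIV_chain2[where f = \<phi> and g = "\<lambda>u. w0 + u", OF \<phi>'[OF pos]]) (auto intro!: derivative_eq_intros)
    then have d1: "((\<lambda>u. \<phi> (w0 + u)) has_field_derivative 2 / ((w0 + u)\<^sup>2 - c) + 2 * (w0 + u)) (at u)"
      by simp
    have d2: "((\<lambda>u. \<kappa> / 2 * u\<^sup>2) has_field_derivative \<kappa> * u) (at u)"
      by (auto intro!: derivative_eq_intros)
    have d3: "((\<lambda>u. c2 / 3 * u ^ 3) has_field_derivative c2 * u\<^sup>2) (at u)"
      by (auto intro!: derivative_eq_intros)
    have "((\<lambda>u. \<phi> (w0 + u) - \<phi> w0) has_field_derivative 2 / ((w0 + u)\<^sup>2 - c) + 2 * (w0 + u)) (at u)"
      using DERIV_diff[OF d1 DERIV_const[of "\<phi> w0"]] by simp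
    from DERIV_diff[OF DERIV_diff[OF this d2] d3]
    have "(h has_field_derivative 2 / ((w0 + u)\<^sup>2 - c) + 2 * (w0 + u) - \<kappa> * u - c2 * u\<^sup>2) (at u)"
      unfolding h_def[abs_def] .
    then show "(h has_field_derivative (2 / ((w0 + u)\<^sup>2 - c) + 2 * (w0 + u) - \<kappa> * u - c2 * u\<^sup>2)) (at u within Seg)"
      by (rule has_field_derivative_at_within)
    define D where "D = (w0 + u)\<^sup>2 - c"
    have D_ge: "cmod D \<ge> (b / 2)\<^sup>2"
    proof -
      have "D = (w0 + u - of_real d) * (w0 + u + of_real d)"
        by (simp add: D_def c_def power2_eq_square algebra_simps)
      moreover have "cmod (w0 + u - of_real d) \<ge> b / 2" "cmod (w0 + u + of_real d) \<ge> b / 2"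
        using Im_w abs_Im_le_cmod[of "w0 + u - of_real d"] abs_Im_le_cmod[of "w0 + u + of_real d"]
        by simp_all
      ultimately show ?thesis
        using b unfolding power2_eq_square by (simp only: norm_mult) (intro mult_mono; simp)
    qed
    have b2: "(b / 2)\<^sup>2 > 0" using b by simp
    then have D_nz: "D \<noteq> 0" using D_ge by auto
    have u1: "cmod u \<le> 1" using u_le r by simp
    have bound: "cmod (- 8 * w0 ^ 4 - 2 * w0 ^ 3 * u + 2 * w0 ^ 3 * (2 * w0 + u) ^ 3 / D) \<le> M"
    proof -
      have p: "cmod w0 ^ k \<le> 1" for k using w0_le by (simp add: power_le_one)
      have "cmod (- 8 * w0 ^ 4) \<le> 8" using p[of 4] by (simp add: norm_mult norm_power)
      moreover have "cmod (2 * w0 ^ 3 * u) \<le> 2"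
        using mult_mono[OF p[of 3] u1] by (simp add: norm_mult norm_power)
      moreover have "cmod (2 * w0 ^ 3 * (2 * w0 + u) ^ 3 / D) \<le> 2 * 3 ^ 3 / (b / 2)\<^sup>2"
      proof -
        have "cmod (2 * w0 + u) \<le> 3"
          using norm_triangle_ineq[of "2 * w0" u] w0_le u1 by (simp add: norm_mult)
        then have "cmod (2 * w0 + u) ^ 3 \<le> 3 ^ 3" by (intro power_mono) auto
        then have "cmod w0 ^ 3 * cmod (2 * w0 + u) ^ 3 \<le> 1 * 3 ^ 3"
          using p[of 3] by (intro mult_mono) auto
        then have "cmod (2 * w0 ^ 3 * (2 * w0 + u) ^ 3) \<le> 2 * 3 ^ 3"
          by (simp add: norm_mult norm_power)
        then show ?thesis
          using D_ge b2 unfolding norm_divide by (intro frac_le) auto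
      qed
      moreover have "(2::real) * 3 ^ 3 / (b / 2)\<^sup>2 = 216 / b\<^sup>2"
        by (simp add: power_divide)
      moreover have "10 \<le> 10 / b\<^sup>2"
        using b b1 by (simp add: le_divide_eq power_le_one)
      moreover have "10 / b\<^sup>2 + 216 / b\<^sup>2 = M" by (simp add: M_def add_divide_distrib[symmetric])
      ultimately show ?thesis
        using norm_triangle_ineq[of "- 8 * w0 ^ 4 - 2 * w0 ^ 3 * u" "2 * w0 ^ 3 * (2 * w0 + u) ^ 3 / D"]
          norm_triangle_ineq4[of "- 8 * w0 ^ 4" "2 * w0 ^ 3 * u"] by linarith
    qed
    have "2 / ((w0 + u)\<^sup>2 - c) + 2 * (w0 + u) - \<kappa> * u - c2 * u\<^sup>2
       = u ^ 3 * (- 8 * w0 ^ 4 - 2 * w0 ^ 3 * u + 2 * w0 ^ 3 * (2 * w0 + u) ^ 3 / D)"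
      using phase_derivative_expansion[OF D0 D_def D_nz] unfolding D_def \<kappa>_def c2_def .
    also have "cmod \<dots> \<le> r ^ 3 * M"
      unfolding norm_mult norm_power using bound u_le r
      by (intro mult_mono power_mono) auto
    finally show "cmod (2 / ((w0 + u)\<^sup>2 - c) + 2 * (w0 + u) - \<kappa> * u - c2 * u\<^sup>2) \<le> M * r ^ 3"
      by (simp add: mult.commute)
  qed (auto simp: Seg_def)
  moreover have "h 0 = 0" by (simp add: h_def)
  moreover have "M * r ^ 3 * norm (of_real v * \<i> - 0) = 226 / b\<^sup>2 * v ^ 4"
    by (simp add: norm_mult M_def r_def eval_nat_numeral abs_mult[symmetric])
  ultimately have 1: "cmod (h (of_real v * \<i>)) \<le> 226 / b\<^sup>2 * v ^ 4" by simp
  have pos: "Im (w0 + of_real v * \<i>) > 0" "Im w0 > 0"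
    using b v by (simp_all add: w0_def abs_le_iff)
  have "\<phi> (w0 + of_real v * \<i>) = \<phi> w0 + (- (2 - 4 * w0 ^ 3) / 2 * of_real (v\<^sup>2)
        + \<tau> * of_real v ^ 3 + h (of_real v * \<i>))"
    by (simp add: h_def \<kappa>_def c2_def \<tau>_def power_mult_distrib power3_eq_cube power2_eq_square algebra_simps
         add_divide_distrib diff_divide_distrib)
  then have 2: "kern n d (w0 + of_real v * \<i>) = kern n d w0 *
      exp (of_real (real n * d) * (- (2 - 4 * w0 ^ 3) / 2 * of_real (v\<^sup>2) + \<tau> * of_real v ^ 3 + h (of_real v * \<i>)))"
    unfolding kern_eq[OF pos(1)] kern_eq[OF pos(2)] by (simp only: distrib_left exp_add)
  from that[OF 1 2] show ?thesis .
qed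

section \<open>Comparison of the integrand with a corrected Gaussian\<close>

lemma norm_exp_sub_linear_le:
  fixes z :: complex
  shows "cmod (exp z - 1 - z) \<le> (cmod z)\<^sup>2 * exp (cmod z)"
proof -
  have "cmod (exp z - (\<Sum>k\<le>1. z ^ k / fact k)) \<le> exp \<bar>Re z\<bar> * cmod z ^ Suc 1 / fact 1"
    by (rule Taylor_exp)
  then have "cmod (exp z - 1 - z) \<le> exp \<bar>Re z\<bar> * (cmod z)\<^sup>2"
    by (simp add: diff_diff_eq power2_eq_square)
  also have "\<dots> \<le> exp (cmod z) * (cmod z)\<^sup>2"
    by (intro mult_right_mono) (auto simp: abs_Re_le_cmod)
  finally show ?thesis by (simp add: mult.commute)
qed

text \<open>In terms of \<open>x = \<Lambda> * v\<^sup>2\<close> the errors \<open>\<Lambda>\<^sup>2 * v ^ 6\<close> from the square of the cubic term and \<open>\<Lambda> * v ^ 4\<close> from the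
remainder are \<open>x ^ 3 / \<Lambda>\<close> and \<open>x\<^sup>2 / \<Lambda>\<close>, which is the gain of a factor \<open>1 / \<Lambda>\<close>. The condition \<open>small\<close>
lets half of the Gaussian decay absorb the exponential of the perturbation.\<close>

lemma perturbed_gaussian_near:
  fixes h \<tau> \<sigma> R :: complex and \<Lambda> v M \<beta> :: real
  assumes \<Lambda>: "\<Lambda> > 0" and h: "Re h \<ge> 4 * \<beta>" and \<tau>: "cmod \<tau> \<le> 4" and \<sigma>: "cmod \<sigma> \<le> 2"
    and R: "cmod R \<le> M * v ^ 4" and M: "M \<ge> 0" and v: "\<bar>v\<bar> \<le> 1" and small: "4 * \<bar>v\<bar> + M * v\<^sup>2 \<le> 2 * \<beta>"
  shows "cmod (exp (of_real \<Lambda> * (- h * of_real (v\<^sup>2) + \<tau> * of_real v ^ 3 + R)) * (1 + \<sigma> * of_real v)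
           - exp (- (of_real \<Lambda> * h) * of_real (v\<^sup>2)) * (1 + of_real \<Lambda> * \<tau> * of_real v ^ 3 + \<sigma> * of_real v))
     \<le> (3 * (4 + M)\<^sup>2 + 3 * M + 8) / \<Lambda> * ((1 + \<Lambda> * v\<^sup>2) ^ 3 * exp (- (2 * \<beta>) * (\<Lambda> * v\<^sup>2)))"
proof -
  define x where "x = \<Lambda> * v\<^sup>2"
  have x: "x \<ge> 0" using \<Lambda> by (simp add: x_def)
  define t where "t = \<bar>v\<bar>"
  have t: "0 \<le> t" "t \<le> 1" "v\<^sup>2 = t\<^sup>2" "v ^ 4 = t ^ 4" "cmod (of_real v) = t"
    using v by (simp_all add: t_def)
  have xt: "x = \<Lambda> * t\<^sup>2" unfolding x_def t(3) ..
  have R': "cmod R \<le> M * t ^ 4" using R unfolding t(4) .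
  have small': "4 * t + M * t\<^sup>2 \<le> 2 * \<beta>" using small unfolding t(3) t_def[symmetric] .
  define Z where "Z = of_real \<Lambda> * (\<tau> * of_real v ^ 3 + R)"
  define G where "G = exp (- (of_real \<Lambda> * h) * of_real (v\<^sup>2))"
  define T where "T = of_real \<Lambda> * \<tau> * of_real v ^ 3"
  have "exp (of_real \<Lambda> * (- h * of_real (v\<^sup>2) + \<tau> * of_real v ^ 3 + R)) = G * exp Z"
    unfolding G_def Z_def exp_add[symmetric] by (simp add: algebra_simps)
  then have "exp (of_real \<Lambda> * (- h * of_real (v\<^sup>2) + \<tau> * of_real v ^ 3 + R)) * (1 + \<sigma> * of_real v)
           - exp (- (of_real \<Lambda> * h) * of_real (v\<^sup>2)) * (1 + of_real \<Lambda> * \<tau> * of_real v ^ 3 + \<sigma> * of_real v)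
      = G * ((exp Z - 1 - Z + of_real \<Lambda> * R) * (1 + \<sigma> * of_real v) + T * (\<sigma> * of_real v))"
    unfolding G_def[symmetric] T_def Z_def by (simp add: algebra_simps)
  also have "cmod \<dots> \<le> exp (- (4 * \<beta>) * x) *
      (((4 + M)\<^sup>2 * x ^ 3 / \<Lambda> + M * x\<^sup>2 / \<Lambda>) * exp (2 * \<beta> * x) * 3 + 8 * x\<^sup>2 / \<Lambda> * exp (2 * \<beta> * x))"
    unfolding norm_mult[of G]
  proof (rule mult_mono)
    have "- (\<Lambda> * v\<^sup>2) * Re h \<le> - (4 * \<beta>) * (\<Lambda> * v\<^sup>2)"
      using mult_left_mono[OF h, of "\<Lambda> * v\<^sup>2"] \<Lambda> by (simp add: mult.commute)
    then show "cmod G \<le> exp (- (4 * \<beta>) * x)"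
      by (simp add: G_def x_def mult_ac)
    have t43: "t ^ 4 \<le> t ^ 3"
      using t by (intro power_decreasing) auto
    have Z1: "cmod Z \<le> \<Lambda> * (4 * t ^ 3 + M * t ^ 4)"
    proof -
      have "cmod (\<tau> * of_real v ^ 3 + R) \<le> 4 * t ^ 3 + M * t ^ 4"
        using norm_triangle_ineq[of "\<tau> * of_real v ^ 3" R] R' mult_right_mono[OF \<tau>, of "t ^ 3"] t(1)
        unfolding norm_mult norm_power t(5) by auto
      then show ?thesis using \<Lambda> by (simp add: Z_def norm_mult)
    qed
    have "\<Lambda> * (4 * t ^ 3 + M * t ^ 4) = x * (4 * t + M * t\<^sup>2)"
      by (simp add: xt algebra_simps eval_nat_numeral)
    also have "\<dots> \<le> x * (2 * \<beta>)" using small' x by (intro mult_left_mono)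
    finally have Z2: "cmod Z \<le> 2 * \<beta> * x" using Z1 by (simp add: mult_ac)
    have "\<beta> \<ge> 0" using small' M t(1) mult_nonneg_nonneg[OF M zero_le_power2[of t]] by linarith
    then have e1: "exp (2 * \<beta> * x) \<ge> 1" using x by simp
    have "cmod Z \<le> \<Lambda> * ((4 + M) * t ^ 3)"
    proof -
      have "4 * t ^ 3 + M * t ^ 4 \<le> (4 + M) * t ^ 3"
        using mult_left_mono[OF t43 M] by (simp add: distrib_right)
      then have "\<Lambda> * (4 * t ^ 3 + M * t ^ 4) \<le> \<Lambda> * ((4 + M) * t ^ 3)"
        using \<Lambda> by (intro mult_left_mono) auto
      with Z1 show ?thesis by linarith
    qed
    then have "(cmod Z)\<^sup>2 \<le> (\<Lambda> * ((4 + M) * t ^ 3))\<^sup>2" by (intro power_mono) auto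
    also have "\<dots> = (4 + M)\<^sup>2 * x ^ 3 / \<Lambda>"
      using \<Lambda> by (simp add: xt power_mult_distrib eval_nat_numeral mult_ac)
    finally have Zsq: "(cmod Z)\<^sup>2 \<le> (4 + M)\<^sup>2 * x ^ 3 / \<Lambda>" .
    have "cmod (exp Z - 1 - Z) \<le> (4 + M)\<^sup>2 * x ^ 3 / \<Lambda> * exp (2 * \<beta> * x)"
      using norm_exp_sub_linear_le[of Z] mult_mono[OF Zsq, of "exp (cmod Z)" "exp (2 * \<beta> * x)"] Z2 x \<Lambda>
      by simp
    moreover have "cmod (of_real \<Lambda> * R) \<le> M * x\<^sup>2 / \<Lambda> * exp (2 * \<beta> * x)"
    proof -
      have "cmod (of_real \<Lambda> * R) \<le> \<Lambda> * (M * t ^ 4)"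
        using R' \<Lambda> by (simp add: norm_mult)
      also have "\<dots> = M * x\<^sup>2 / \<Lambda> * 1"
        using \<Lambda> by (simp add: xt power_mult_distrib eval_nat_numeral mult_ac)
      also have "\<dots> \<le> M * x\<^sup>2 / \<Lambda> * exp (2 * \<beta> * x)"
        using e1 M \<Lambda> by (intro mult_left_mono) auto
      finally show ?thesis .
    qed
    ultimately have A: "cmod (exp Z - 1 - Z + of_real \<Lambda> * R) \<le> ((4 + M)\<^sup>2 * x ^ 3 / \<Lambda> + M * x\<^sup>2 / \<Lambda>) * exp (2 * \<beta> * x)"
      using norm_triangle_ineq[of "exp Z - 1 - Z" "of_real \<Lambda> * R"] by (simp add: distrib_right)
    have sv: "cmod (\<sigma> * of_real v) \<le> 2 * t"
      using mult_right_mono[OF \<sigma> t(1)] by (simp only: norm_mult t(5))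
    then have B: "cmod (1 + \<sigma> * of_real v) \<le> 3"
      using norm_triangle_ineq[of 1 "\<sigma> * of_real v"] t(2) by simp
    have C: "cmod (T * (\<sigma> * of_real v)) \<le> 8 * x\<^sup>2 / \<Lambda> * exp (2 * \<beta> * x)"
    proof -
      have "cmod T \<le> \<Lambda> * 4 * t ^ 3"
        unfolding T_def norm_mult norm_power t(5) using \<tau> \<Lambda> t(1) by (intro mult_mono) auto
      then have "cmod (T * (\<sigma> * of_real v)) \<le> (\<Lambda> * 4 * t ^ 3) * (2 * t)"
        unfolding norm_mult[of T] using sv \<Lambda> t(1) by (intro mult_mono) auto
      also have "\<dots> = 8 * x\<^sup>2 / \<Lambda> * 1"
        using \<Lambda> by (simp add: xt power_mult_distrib eval_nat_numeral mult_ac)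
      also have "\<dots> \<le> 8 * x\<^sup>2 / \<Lambda> * exp (2 * \<beta> * x)"
        using e1 \<Lambda> by (intro mult_left_mono) auto
      finally show ?thesis .
    qed
    have "cmod ((exp Z - 1 - Z + of_real \<Lambda> * R) * (1 + \<sigma> * of_real v)) \<le>
        ((4 + M)\<^sup>2 * x ^ 3 / \<Lambda> + M * x\<^sup>2 / \<Lambda>) * exp (2 * \<beta> * x) * 3"
      unfolding norm_mult using A B x M \<Lambda> by (intro mult_mono) auto
    with C show "cmod ((exp Z - 1 - Z + of_real \<Lambda> * R) * (1 + \<sigma> * of_real v) + T * (\<sigma> * of_real v))
      \<le> ((4 + M)\<^sup>2 * x ^ 3 / \<Lambda> + M * x\<^sup>2 / \<Lambda>) * exp (2 * \<beta> * x) * 3 + 8 * x\<^sup>2 / \<Lambda> * exp (2 * \<beta> * x)"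
      using norm_triangle_ineq[of "(exp Z - 1 - Z + of_real \<Lambda> * R) * (1 + \<sigma> * of_real v)" "T * (\<sigma> * of_real v)"]
      by linarith
  qed auto
  also have "\<dots> = (3 * (4 + M)\<^sup>2 * x ^ 3 + (3 * M + 8) * x\<^sup>2) / \<Lambda> * (exp (- (4 * \<beta>) * x) * exp (2 * \<beta> * x))"
    by (simp add: algebra_simps add_divide_distrib)
  also have "exp (- (4 * \<beta>) * x) * exp (2 * \<beta> * x) = exp (- (2 * \<beta>) * x)"
    by (simp add: exp_add[symmetric])
  also have "(3 * (4 + M)\<^sup>2 * x ^ 3 + (3 * M + 8) * x\<^sup>2) / \<Lambda> * exp (- (2 * \<beta>) * x)
     \<le> ((3 * (4 + M)\<^sup>2 + 3 * M + 8) * (1 + x) ^ 3) / \<Lambda> * exp (- (2 * \<beta>) * x)"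
  proof -
    have "x ^ 3 \<le> (1 + x) ^ 3" using x by (intro power_mono) auto
    moreover have "x\<^sup>2 \<le> (1 + x) ^ 3"
    proof -
      have "x\<^sup>2 \<le> (1 + x)\<^sup>2" using x by (intro power_mono) auto
      also have "\<dots> \<le> (1 + x) ^ 3" using x by (intro power_increasing) auto
      finally show ?thesis .
    qed
    ultimately have "3 * (4 + M)\<^sup>2 * x ^ 3 + (3 * M + 8) * x\<^sup>2 \<le>
        3 * (4 + M)\<^sup>2 * (1 + x) ^ 3 + (3 * M + 8) * (1 + x) ^ 3"
      using M by (intro add_mono mult_left_mono) auto
    also have "\<dots> = (3 * (4 + M)\<^sup>2 + 3 * M + 8) * (1 + x) ^ 3" by (simp only: distrib_right add.assoc)
    finally show ?thesis using \<Lambda> by (intro mult_right_mono divide_right_mono) auto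
  qed
  finally show ?thesis unfolding x_def by (simp add: mult_ac)
qed

text \<open>At distance \<open>\<eta>\<close> from the saddle no cancellation is needed: there \<open>1 \<le> v\<^sup>2 / \<eta>\<^sup>2 = x / (\<Lambda> * \<eta>\<^sup>2)\<close>
for \<open>x = \<Lambda> * v\<^sup>2\<close>, so even the trivial bound carries the factor \<open>1 / \<Lambda>\<close>.\<close>

lemma perturbed_gaussian_far:
  fixes h \<tau> \<sigma> E :: complex and \<Lambda> v \<eta> q :: real
  assumes \<Lambda>: "\<Lambda> > 0" and h: "Re h \<ge> q" and \<tau>: "cmod \<tau> \<le> 4" and \<sigma>: "cmod \<sigma> \<le> 2"
    and \<eta>: "0 < \<eta>" "\<eta> \<le> \<bar>v\<bar>"
    and E: "cmod E \<le> exp (- q * (\<Lambda> * v\<^sup>2)) * (1 + 2 * \<bar>v\<bar>)"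
  shows "cmod (E - exp (- (of_real \<Lambda> * h) * of_real (v\<^sup>2)) * (1 + of_real \<Lambda> * \<tau> * of_real v ^ 3 + \<sigma> * of_real v))
     \<le> (2 / \<eta>\<^sup>2 + 8 / \<eta>) / \<Lambda> * ((1 + \<Lambda> * v\<^sup>2) ^ 3 * exp (- q * (\<Lambda> * v\<^sup>2)))"
proof -
  define x where "x = \<Lambda> * v\<^sup>2"
  have x: "x \<ge> 0" using \<Lambda> by (simp add: x_def)
  define t where "t = \<bar>v\<bar>"
  have t: "t > 0" "\<eta> \<le> t" "v\<^sup>2 = t\<^sup>2" using \<eta> by (auto simp: t_def)
  have "- (\<Lambda> * v\<^sup>2) * Re h \<le> - q * (\<Lambda> * v\<^sup>2)"
    using mult_left_mono[OF h, of "\<Lambda> * v\<^sup>2"] \<Lambda> by (simp add: mult.commute)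
  then have G: "cmod (exp (- (of_real \<Lambda> * h) * of_real (v\<^sup>2))) \<le> exp (- q * x)"
    by (simp add: x_def mult_ac)
  have "cmod (1 + of_real \<Lambda> * \<tau> * of_real v ^ 3 + \<sigma> * of_real v) \<le> 1 + \<Lambda> * 4 * t ^ 3 + 2 * t"
  proof -
    have "cmod (of_real \<Lambda> * \<tau> * of_real v ^ 3) \<le> \<Lambda> * 4 * t ^ 3"
      unfolding norm_mult norm_power t_def using \<tau> \<Lambda> by (intro mult_mono) auto
    moreover have "cmod (\<sigma> * of_real v) \<le> 2 * t"
      using \<sigma> by (simp add: norm_mult mult_right_mono t_def)
    ultimately show ?thesis
      using norm_triangle_ineq[of "1 + of_real \<Lambda> * \<tau> * of_real v ^ 3" "\<sigma> * of_real v"]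
        norm_triangle_ineq[of 1 "of_real \<Lambda> * \<tau> * of_real v ^ 3"] by simp
  qed
  with G have "cmod (exp (- (of_real \<Lambda> * h) * of_real (v\<^sup>2)) * (1 + of_real \<Lambda> * \<tau> * of_real v ^ 3 + \<sigma> * of_real v))
      \<le> exp (- q * x) * (1 + \<Lambda> * 4 * t ^ 3 + 2 * t)"
    unfolding norm_mult by (intro mult_mono) auto
  with E have "cmod (E - exp (- (of_real \<Lambda> * h) * of_real (v\<^sup>2)) * (1 + of_real \<Lambda> * \<tau> * of_real v ^ 3 + \<sigma> * of_real v))
      \<le> exp (- q * x) * (1 + 2 * t) + exp (- q * x) * (1 + \<Lambda> * 4 * t ^ 3 + 2 * t)"
    unfolding t_def x_def
    using norm_triangle_ineq4[of E "exp (- (of_real \<Lambda> * h) * of_real (v\<^sup>2)) * (1 + of_real \<Lambda> * \<tau> * of_real v ^ 3 + \<sigma> * of_real v)"]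
    by linarith
  also have "\<dots> = exp (- q * x) * (2 + 4 * t + 4 * (\<Lambda> * t ^ 3))"
    by (simp add: algebra_simps)
  also have "\<dots> \<le> exp (- q * x) * ((2 / \<eta>\<^sup>2 + 8 / \<eta>) / \<Lambda> * (1 + x) ^ 3)"
  proof (rule mult_left_mono)
    have 1: "1 \<le> t\<^sup>2 / \<eta>\<^sup>2" using \<eta> t by (simp add: power_mono)
    have 2: "t \<le> t\<^sup>2 / \<eta>" using \<eta> t by (simp add: power2_eq_square field_simps)
    have 3: "\<Lambda> * t ^ 3 \<le> \<Lambda> * (t ^ 4 / \<eta>)"
      using \<eta> t \<Lambda> by (intro mult_left_mono) (simp_all add: eval_nat_numeral field_simps)
    have "2 + 4 * t + 4 * (\<Lambda> * t ^ 3) \<le> 2 * (t\<^sup>2 / \<eta>\<^sup>2) + 4 * (t\<^sup>2 / \<eta>) + 4 * (\<Lambda> * (t ^ 4 / \<eta>))"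
      using 1 2 3 by linarith
    also have "\<dots> = ((2 / \<eta>\<^sup>2 + 4 / \<eta>) * x + 4 / \<eta> * x\<^sup>2) / \<Lambda>"
      using \<Lambda> \<eta> unfolding x_def t(3) by (simp add: field_simps eval_nat_numeral)
    also have "\<dots> \<le> ((2 / \<eta>\<^sup>2 + 4 / \<eta>) * (1 + x) ^ 3 + 4 / \<eta> * (1 + x) ^ 3) / \<Lambda>"
    proof (intro divide_right_mono add_mono mult_left_mono)
      show "x \<le> (1 + x) ^ 3"
        using x self_le_power[of "1 + x" 3] by simp
      have "x\<^sup>2 \<le> (1 + x)\<^sup>2" using x by (intro power_mono) auto
      also have "\<dots> \<le> (1 + x) ^ 3" using x by (intro power_increasing) auto
      finally show "x\<^sup>2 \<le> (1 + x) ^ 3" .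
    qed (use \<eta> \<Lambda> in auto)
    also have "\<dots> = (2 / \<eta>\<^sup>2 + 8 / \<eta>) / \<Lambda> * (1 + x) ^ 3"
      by (simp add: distrib_right add_divide_distrib)
    finally show "2 + 4 * t + 4 * (\<Lambda> * t ^ 3) \<le> (2 / \<eta>\<^sup>2 + 8 / \<eta>) / \<Lambda> * (1 + x) ^ 3" .
  qed auto
  finally show ?thesis unfolding x_def by (simp add: mult_ac)
qed

lemma kern_nonzero:
  assumes "Im w \<noteq> 0"
  shows "kern n d w \<noteq> 0"
proof -
  have "w - of_real d \<noteq> 0" "w + of_real d \<noteq> 0"
    using assms by (auto simp: complex_eq_iff)
  then show ?thesis by (simp add: kern_def)
qed

text \<open>The radius \<open>\<eta>\<close> separates the region of the local expansion from the region where the global decay on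
the line is used. The indicator restricts the line to the upper half-plane; elsewhere the
comparison function itself is small enough.\<close>

lemma saddle_integrand_near_gaussian:
  fixes b0 :: real
  assumes b0: "0 < b0"
  obtains C where "C \<ge> 0" and
    "\<And>d a b n v. \<lbrakk>scaled_saddle d a b; b0 \<le> b; n \<ge> 1\<rbrakk> \<Longrightarrow>
      cmod (indicator {0..} (b + v) *\<^sub>R
          (Complex a (b + v) / Complex a b * (kern n d (Complex a (b + v)) / kern n d (Complex a b)))
        - exp (- (of_real (real n * d) * (1 - 2 * Complex a b ^ 3)) * of_real (v\<^sup>2)) *
          (1 + of_real (real n * d) * (\<i> * (2 * (Complex a b)\<^sup>2 + 8 * Complex a b ^ 5) / 3) * of_real v ^ 3
             + \<i> / Complex a b * of_real v))
      \<le> C / (real n * d) * exp (- (b0\<^sup>2 / 18) * (real n * d * v\<^sup>2))"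
proof -
  \<comment> \<open>\<open>M\<close> bounds the remainder constant of the local expansion, \<open>\<eta>\<close> is small enough for
     \<open>4 * \<eta> + M * \<eta>\<^sup>2 \<le> 2 * b0\<^sup>2\<close>, and \<open>q\<close> is the rate of decay along the whole half-line.\<close>
  define M where "M = 226 / b0\<^sup>2"
  define \<eta> where "\<eta> = b0 ^ 4 / 16"
  define q where "q = b0\<^sup>2 / 9"
  define C1 where "C1 = 3 * (4 + M)\<^sup>2 + 3 * M + 8"
  define C2 where "C2 = 2 / \<eta>\<^sup>2 + 8 / \<eta>"
  define m where "m = (max 1 (6 / q)) ^ 3"
  have pos: "M \<ge> 0" "\<eta> > 0" "q > 0" "C1 \<ge> 0" "C2 \<ge> 0" "m \<ge> 0"
    using b0 by (auto simp: M_def \<eta>_def q_def C1_def C2_def m_def)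
  show ?thesis
  proof (rule that)
    show "(C1 + C2) * m \<ge> 0" using pos by simp
    fix d a b v :: real and n :: nat
    assume sad: "scaled_saddle d a b" and b: "b0 \<le> b" and n: "n \<ge> 1"
    have d: "d > 0" and a: "a > 0" and b_pos: "b > 0" using sad by (auto simp: scaled_saddle_def)
    note bds = scaled_saddle_bounds[OF sad]
    have b0_1: "b0 \<le> 1" using b bds(3) by simp
    define w0 where "w0 = Complex a b"
    define \<Lambda> where "\<Lambda> = real n * d"
    define h where "h = 1 - 2 * w0 ^ 3"
    define \<tau> where "\<tau> = \<i> * (2 * w0\<^sup>2 + 8 * w0 ^ 5) / 3"
    define \<sigma> where "\<sigma> = \<i> / w0"
    define k0 where "k0 = kern n d w0"
    define E where "E = indicator {0..} (b + v) *\<^sub>R (Complex a (b + v) / w0 * (kern n d (Complex a (b + v)) / k0))"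
    define x where "x = \<Lambda> * v\<^sup>2"
    have \<Lambda>: "\<Lambda> > 0" using d n by (simp add: \<Lambda>_def)
    have x: "x \<ge> 0" using \<Lambda> by (simp add: x_def)
    have w0_nz: "w0 \<noteq> 0" using a by (simp add: w0_def complex_eq_iff)
    have k0_nz: "k0 \<noteq> 0"
      unfolding k0_def by (rule kern_nonzero) (use b_pos in \<open>simp add: w0_def\<close>)
    have wv: "Complex a (b + v) = w0 + of_real v * \<i>" by (simp add: w0_def complex_eq_iff)
    have ratio: "Complex a (b + v) / w0 = 1 + \<sigma> * of_real v"
      using w0_nz by (simp add: wv \<sigma>_def add_divide_distrib)
    have w0_le: "cmod w0 \<le> 1" using norm_scaled_saddle(1)[OF sad] by (simp add: w0_def)
    have \<sigma>: "cmod \<sigma> \<le> 2"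
      using norm_scaled_saddle(2)[OF sad] by (simp add: \<sigma>_def w0_def norm_divide)
    have \<tau>: "cmod \<tau> \<le> 4"
    proof -
      have p: "cmod w0 ^ k \<le> 1" for k using w0_le by (simp add: power_le_one)
      have "cmod (2 * w0\<^sup>2) \<le> 2" "cmod (8 * w0 ^ 5) \<le> 8"
        using p[of 2] p[of 5] by (simp_all add: norm_mult norm_power)
      then have "cmod (2 * w0\<^sup>2 + 8 * w0 ^ 5) \<le> 10"
        using norm_triangle_ineq[of "2 * w0\<^sup>2" "8 * w0 ^ 5"] by simp
      then show ?thesis by (simp add: \<tau>_def norm_mult norm_divide)
    qed
    have b0b: "b0\<^sup>2 \<le> b\<^sup>2" using b0 b by (intro power_mono) auto
    have h_eq: "h = 3 - 2 * of_real (d\<^sup>2) * w0"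
    proof -
      have "w0 ^ 3 = of_real (d\<^sup>2) * w0 - 1"
        using scaled_saddle_cubic[OF sad] unfolding w0_def[symmetric]
        by (simp add: algebra_simps eq_neg_iff_add_eq_0 add_eq_0_iff)
      then show ?thesis unfolding h_def by (simp only:) (simp add: algebra_simps)
    qed
    have "Re h = 8 * (a * b\<^sup>2)"
      using bds(7) by (simp add: h_eq w0_def del: of_real_power)
    moreover have "1 / 2 * b\<^sup>2 \<le> a * b\<^sup>2" using bds(1) by (intro mult_right_mono) auto
    ultimately have h: "Re h \<ge> 4 * b0\<^sup>2" using b0b by linarith
    then have hq: "Re h \<ge> q" using zero_le_power2[of b0] unfolding q_def by linarith
    let ?G = "exp (- (of_real \<Lambda> * h) * of_real (v\<^sup>2)) * (1 + of_real \<Lambda> * \<tau> * of_real v ^ 3 + \<sigma> * of_real v)"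
    have key: "cmod (E - ?G) \<le> (C1 + C2) / \<Lambda> * ((1 + x) ^ 3 * exp (- q * x))"
    proof (cases "\<bar>v\<bar> \<le> \<eta>")
      case True
      have b0_4: "b0 ^ 4 \<le> b0\<^sup>2" "b0 ^ 4 \<le> b0"
        using b0 b0_1 power_decreasing[of 2 4 b0] power_decreasing[of 1 4 b0] by simp_all
      have \<eta>_b: "\<eta> \<le> b / 2" "\<eta> \<le> 1" using b0_4 b b0_1 b0 by (auto simp: \<eta>_def)
      have v_b: "\<bar>v\<bar> \<le> b / 2" "\<bar>v\<bar> \<le> 1" using True \<eta>_b by auto
      obtain R where R: "cmod R \<le> 226 / b\<^sup>2 * v ^ 4"
        and kern_v: "kern n d (w0 + of_real v * \<i>) = k0 *
          exp (of_real \<Lambda> * (- (2 - 4 * w0 ^ 3) / 2 * of_real (v\<^sup>2) + \<tau> * of_real v ^ 3 + R))"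
        using kern_local_expansion[OF sad v_b(1), of n] unfolding w0_def k0_def \<Lambda>_def \<tau>_def by blast
      have "226 / b\<^sup>2 \<le> M"
        unfolding M_def using b0b b0 b_pos by (intro divide_left_mono) auto
      then have "226 / b\<^sup>2 * v ^ 4 \<le> M * v ^ 4" by (intro mult_right_mono) auto
      with R have R: "cmod R \<le> M * v ^ 4" by linarith
      have "(2 - 4 * w0 ^ 3) / 2 = h" by (simp add: h_def field_simps)
      then have kern_v': "kern n d (Complex a (b + v)) / k0 =
          exp (of_real \<Lambda> * (- h * of_real (v\<^sup>2) + \<tau> * of_real v ^ 3 + R))"
        unfolding wv kern_v using k0_nz by (simp add: minus_divide_left[symmetric] del: of_real_power)
      have "0 \<le> b + v" using v_b b_pos by (simp add: abs_le_iff)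
      then have E_eq: "E = exp (of_real \<Lambda> * (- h * of_real (v\<^sup>2) + \<tau> * of_real v ^ 3 + R)) * (1 + \<sigma> * of_real v)"
        unfolding E_def ratio kern_v' by simp
      have small: "4 * \<bar>v\<bar> + M * v\<^sup>2 \<le> 2 * b0\<^sup>2"
      proof -
        have "4 * \<bar>v\<bar> \<le> b0\<^sup>2" using True b0_4 by (simp add: \<eta>_def)
        moreover have "M * v\<^sup>2 \<le> b0\<^sup>2"
        proof -
          have "v\<^sup>2 \<le> \<eta>\<^sup>2" using True pos by (simp add: abs_le_square_iff[symmetric])
          also have "\<eta>\<^sup>2 = b0 ^ 4 * b0 ^ 4 / 256" by (simp add: \<eta>_def power2_eq_square)
          also have "\<dots> \<le> b0 ^ 4 * 1 / 256"
            using b0 b0_1 by (intro divide_right_mono mult_left_mono) (auto simp: power_le_one)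
          finally have "M * v\<^sup>2 \<le> M * (b0 ^ 4 / 256)" using pos by (intro mult_left_mono) auto
          also have "\<dots> = 226 / 256 * b0\<^sup>2" using b0 by (simp add: M_def eval_nat_numeral)
          also have "\<dots> \<le> b0\<^sup>2" by simp
          finally show ?thesis .
        qed
        ultimately show ?thesis by simp
      qed
      have "cmod (E - ?G) \<le> C1 / \<Lambda> * ((1 + x) ^ 3 * exp (- (2 * b0\<^sup>2) * x))"
        unfolding E_eq C1_def x_def
        by (rule perturbed_gaussian_near[OF \<Lambda> h \<tau> \<sigma> R pos(1) v_b(2) small])
      also have "\<dots> \<le> (C1 + C2) / \<Lambda> * ((1 + x) ^ 3 * exp (- q * x))"
      proof (intro mult_mono divide_right_mono)
        have "q \<le> 2 * b0\<^sup>2" by (simp add: q_def)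
        then have "q * x \<le> 2 * b0\<^sup>2 * x" using x by (intro mult_right_mono)
        then show "exp (- (2 * b0\<^sup>2) * x) \<le> exp (- q * x)" by simp
      qed (use pos \<Lambda> x in auto)
      finally show ?thesis .
    next
      case False
      have E_le: "cmod E \<le> exp (- q * (\<Lambda> * v\<^sup>2)) * (1 + 2 * \<bar>v\<bar>)"
      proof (cases "0 \<le> b + v")
        case True
        define y where "y = b + v"
        have y: "y \<ge> 0" using True by (simp add: y_def)
        have Cxy: "of_real a + of_real y * \<i> = Complex a y" for y by (simp add: complex_eq_iff)
        have "cmod (kern n d (Complex a y)) \<le>
            cmod k0 * exp (- (real n * d) * ((y\<^sup>2 - b\<^sup>2)\<^sup>2 / ((a + d)\<^sup>2 + y\<^sup>2)))"
          using norm_kern_vertical_line_le[OF d a bds(6), of n y] unfolding Cxy k0_def w0_def .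
        then have "cmod (kern n d (Complex a y) / k0) \<le>
             exp (- (real n * d) * ((y\<^sup>2 - b\<^sup>2)\<^sup>2 / ((a + d)\<^sup>2 + y\<^sup>2)))"
          using k0_nz by (simp add: norm_divide divide_le_eq mult.commute)
        also have "\<dots> \<le> exp (- q * (\<Lambda> * v\<^sup>2))"
        proof -
          \<comment> \<open>Here \<open>y\<^sup>2 - b\<^sup>2 = v * (y + b)\<close>, and \<open>(y + b)\<^sup>2 \<ge> y\<^sup>2 + b\<^sup>2\<close> because \<open>y \<ge> 0\<close>.\<close>
          have "(a + d)\<^sup>2 \<le> 3\<^sup>2" using a d bds(2,4) by (intro power_mono) auto
          then have ad9: "(a + d)\<^sup>2 + y\<^sup>2 \<le> 9 + y\<^sup>2" by simp
          have ad_pos: "(a + d)\<^sup>2 + y\<^sup>2 > 0" using a d by (simp add: add_pos_nonneg)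
          have "q * ((a + d)\<^sup>2 + y\<^sup>2) \<le> q * (9 + y\<^sup>2)" using ad9 pos by (intro mult_left_mono) auto
          also have "\<dots> = b0\<^sup>2 + b0\<^sup>2 / 9 * y\<^sup>2" by (simp add: q_def algebra_simps)
          also have "\<dots> \<le> b\<^sup>2 + 1 * y\<^sup>2"
            using b0b b0 b0_1 power_le_one[of b0 2] by (intro add_mono mult_right_mono) auto
          also have "\<dots> \<le> (y + b)\<^sup>2" using y b_pos by (simp add: power2_eq_square algebra_simps)
          finally have "q * ((a + d)\<^sup>2 + y\<^sup>2) * v\<^sup>2 \<le> (y + b)\<^sup>2 * v\<^sup>2" by (intro mult_right_mono) auto
          also have "(y + b)\<^sup>2 * v\<^sup>2 = (y\<^sup>2 - b\<^sup>2)\<^sup>2"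
            by (simp add: y_def power2_eq_square algebra_simps)
          finally have "q * v\<^sup>2 \<le> (y\<^sup>2 - b\<^sup>2)\<^sup>2 / ((a + d)\<^sup>2 + y\<^sup>2)"
            using ad_pos by (simp add: le_divide_eq mult_ac)
          then have "\<Lambda> * (q * v\<^sup>2) \<le> \<Lambda> * ((y\<^sup>2 - b\<^sup>2)\<^sup>2 / ((a + d)\<^sup>2 + y\<^sup>2))"
            using \<Lambda> by (intro mult_left_mono) auto
          then show ?thesis unfolding \<Lambda>_def by (simp add: mult_ac)
        qed
        finally have 1: "cmod (kern n d (Complex a (b + v)) / k0) \<le> exp (- q * (\<Lambda> * v\<^sup>2))"
          by (simp add: y_def)
        have "cmod (\<sigma> * of_real v) \<le> 2 * \<bar>v\<bar>"
          using mult_right_mono[OF \<sigma> abs_ge_zero[of v]] by (simp add: norm_mult)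
        then have 2: "cmod (1 + \<sigma> * of_real v) \<le> 1 + 2 * \<bar>v\<bar>"
          using norm_triangle_ineq[of 1 "\<sigma> * of_real v"] by simp
        have "cmod E = cmod (kern n d (Complex a (b + v)) / k0) * cmod (1 + \<sigma> * of_real v)"
          unfolding E_def ratio using True by (simp add: norm_mult norm_divide mult.commute)
        also have "\<dots> \<le> exp (- q * (\<Lambda> * v\<^sup>2)) * (1 + 2 * \<bar>v\<bar>)"
          using 1 2 by (intro mult_mono) auto
        finally show ?thesis .
      qed (simp add: E_def)
      have "\<eta> \<le> \<bar>v\<bar>" using False by simp
      then have "cmod (E - ?G) \<le> C2 / \<Lambda> * ((1 + x) ^ 3 * exp (- q * x))"
        unfolding C2_def x_def
        by (rule perturbed_gaussian_far[OF \<Lambda> hq \<tau> \<sigma> pos(2) _ E_le])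
      also have "\<dots> \<le> (C1 + C2) / \<Lambda> * ((1 + x) ^ 3 * exp (- q * x))"
        using pos \<Lambda> x by (intro mult_right_mono divide_right_mono) auto
      finally show ?thesis .
    qed
    also have "\<dots> \<le> (C1 + C2) / \<Lambda> * (m * exp (- q * x / 2))"
      unfolding m_def using pos \<Lambda> x by (intro mult_left_mono cubic_le_exp) auto
    also have "\<dots> = (C1 + C2) * m / \<Lambda> * exp (- (b0\<^sup>2 / 18) * x)"
      by (simp add: q_def)
    finally show "cmod (indicator {0..} (b + v) *\<^sub>R
          (Complex a (b + v) / Complex a b * (kern n d (Complex a (b + v)) / kern n d (Complex a b)))
        - exp (- (of_real (real n * d) * (1 - 2 * Complex a b ^ 3)) * of_real (v\<^sup>2)) *
          (1 + of_real (real n * d) * (\<i> * (2 * (Complex a b)\<^sup>2 + 8 * Complex a b ^ 5) / 3) * of_real v ^ 3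
             + \<i> / Complex a b * of_real v))
      \<le> (C1 + C2) * m / (real n * d) * exp (- (b0\<^sup>2 / 18) * (real n * d * v\<^sup>2))"
      unfolding E_def h_def \<tau>_def \<sigma>_def k0_def w0_def \<Lambda>_def x_def .
  qed
qed

text \<open>Half the second derivative of the phase at the saddle. In scaled variables this is the radicand
\<open>3 - 2 * \<alpha> * zeta \<alpha>\<close> of the branch \<open>S\<close>.\<close>

lemma saddle_hessian:
  assumes sad: "scaled_saddle d a b"
  shows "1 - 2 * Complex a b ^ 3 = 3 - 2 * of_real (d\<^sup>2) * Complex a b"
    and "Re (3 - 2 * of_real (d\<^sup>2) * Complex a b) > 0"
    and "cmod (3 - 2 * of_real (d\<^sup>2) * Complex a b) \<le> 16"
proof -
  note bds = scaled_saddle_bounds[OF sad]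
  have d: "d > 0" and a: "a > 0" and b: "b > 0" using sad by (auto simp: scaled_saddle_def)
  have "Complex a b ^ 3 = of_real (d\<^sup>2) * Complex a b - 1"
    using scaled_saddle_cubic[OF sad] by (simp add: algebra_simps add_eq_0_iff)
  then show "1 - 2 * Complex a b ^ 3 = 3 - 2 * of_real (d\<^sup>2) * Complex a b"
    by (simp only:) (simp add: algebra_simps)
  have "Re (3 - 2 * of_real (d\<^sup>2) * Complex a b) = 8 * (a * b\<^sup>2)"
    using bds(7) by (simp del: of_real_power)
  then show "Re (3 - 2 * of_real (d\<^sup>2) * Complex a b) > 0" using a b by simp
  have "d\<^sup>2 \<le> 2\<^sup>2" using d bds(4) by (intro power_mono) auto
  then have "d\<^sup>2 * cmod (Complex a b) \<le> 4 * 1"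
    using norm_scaled_saddle(1)[OF sad] by (intro mult_mono) auto
  then have "cmod (2 * of_real (d\<^sup>2) * Complex a b) \<le> 8" by (simp add: norm_mult norm_power mult.commute)
  then show "cmod (3 - 2 * of_real (d\<^sup>2) * Complex a b) \<le> 16"
    using norm_triangle_ineq4[of 3 "2 * of_real (d\<^sup>2) * Complex a b"] by simp
qed

text \<open>Integrates \<open>saddle_integrand_near_gaussian\<close> over the upper half of the line \<open>Re w = a\<close>. The error is
relative to the value at the saddle, and the constant depends on \<open>b0\<close> alone.\<close>

lemma saddle_integral_estimate:
  fixes b0 :: real
  assumes b0: "0 < b0"
  obtains K where "K \<ge> 0" and
    "\<And>d a b n. \<lbrakk>scaled_saddle d a b; b0 \<le> b; n \<ge> 1\<rbrakk> \<Longrightarrow>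
      cmod ((LINT y:{0..}|lborel. (of_real a + of_real y * \<i>) * kern n d (of_real a + of_real y * \<i>))
        - Complex a b * kern n d (Complex a b) *
          (of_real (sqrt pi) / csqrt (of_real (real n * d) * (3 - 2 * of_real (d\<^sup>2) * Complex a b))))
      \<le> cmod (Complex a b * kern n d (Complex a b)) * (K / (real n * d) / sqrt (real n * d))"
proof -
  obtain C where C: "C \<ge> 0" and close:
    "\<And>d a b n v. \<lbrakk>scaled_saddle d a b; b0 \<le> b; n \<ge> 1\<rbrakk> \<Longrightarrow>
      cmod (indicator {0..} (b + v) *\<^sub>R
          (Complex a (b + v) / Complex a b * (kern n d (Complex a (b + v)) / kern n d (Complex a b)))
        - exp (- (of_real (real n * d) * (1 - 2 * Complex a b ^ 3)) * of_real (v\<^sup>2)) *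
          (1 + of_real (real n * d) * (\<i> * (2 * (Complex a b)\<^sup>2 + 8 * Complex a b ^ 5) / 3) * of_real v ^ 3
             + \<i> / Complex a b * of_real v))
      \<le> C / (real n * d) * exp (- (b0\<^sup>2 / 18) * (real n * d * v\<^sup>2))"
    using saddle_integrand_near_gaussian[OF b0] by blast
  show ?thesis
  proof (rule that)
    show "C * sqrt (18 * pi / b0\<^sup>2) \<ge> 0" using C by simp
    fix d a b :: real and n :: nat
    assume sad: "scaled_saddle d a b" and b: "b0 \<le> b" and n: "n \<ge> 1"
    have d: "d > 0" and a: "a > 0" and b_pos: "b > 0" using sad by (auto simp: scaled_saddle_def)
    define w0 where "w0 = Complex a b"
    define \<Lambda> where "\<Lambda> = real n * d"
    define k0 where "k0 = kern n d w0"
    define z where "z = of_real \<Lambda> * (3 - 2 * of_real (d\<^sup>2) * w0)"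
    have \<Lambda>: "\<Lambda> > 0" using d n by (simp add: \<Lambda>_def)
    have w0_nz: "w0 \<noteq> 0" using a by (simp add: w0_def complex_eq_iff)
    have k0_nz: "k0 \<noteq> 0"
      unfolding k0_def by (rule kern_nonzero) (use b_pos in \<open>simp add: w0_def\<close>)
    have Cxy: "of_real a + of_real y * \<i> = Complex a y" for y by (simp add: complex_eq_iff)
    define g where "g y = indicator {0..} y *\<^sub>R (Complex a y / w0 * (kern n d (Complex a y) / k0))" for y :: real
    define E where "E v = g (b + v)" for v
    have "continuous_on UNIV (\<lambda>y. Complex a y / w0 * (kern n d (Complex a y) / k0))"
      using continuous_on_kern_vertical[OF d less_imp_le[OF a], of UNIV n] w0_nz k0_nz
      unfolding Cxy[symmetric] by (intro continuous_intros) auto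
    then have "(\<lambda>y. Complex a y / w0 * (kern n d (Complex a y) / k0)) \<in> borel_measurable borel"
      by (rule borel_measurable_continuous_onI)
    then have g_meas [measurable]: "g \<in> borel_measurable borel"
      unfolding g_def by (intro borel_measurable_scaleR borel_measurable_indicator) auto
    have E_meas: "E \<in> borel_measurable borel"
      unfolding E_def by measurable
    have Re_z: "Re z > 0"
      using saddle_hessian(2)[OF sad] \<Lambda> unfolding z_def w0_def by (simp del: of_real_power)
    define p where "p = b0\<^sup>2 / 18 * \<Lambda>"
    have p: "p > 0" using b0 \<Lambda> by (simp add: p_def)
    have hess: "1 - 2 * w0 ^ 3 = 3 - 2 * of_real (d\<^sup>2) * w0"
      unfolding w0_def by (rule saddle_hessian(1)[OF sad])
    have p_eq: "- (b0\<^sup>2 / 18) * (\<Lambda> * v\<^sup>2) = - p * v\<^sup>2" for v by (simp add: p_def)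
    have "cmod (E v - exp (- z * of_real (v\<^sup>2)) *
          (1 + of_real \<Lambda> * (\<i> * (2 * w0\<^sup>2 + 8 * w0 ^ 5) / 3) * of_real v ^ 3 + \<i> / w0 * of_real v))
        \<le> C / \<Lambda> * exp (- p * v\<^sup>2)" for v
      using close[OF sad b n, of v]
      unfolding w0_def[symmetric] \<Lambda>_def[symmetric] k0_def[symmetric] hess z_def[symmetric] p_eq
        E_def g_def .
    from integral_near_gaussian[OF E_meas Re_z p this]
    have est: "cmod ((\<integral>v. E v \<partial>lborel) - of_real (sqrt pi) / csqrt z) \<le> C / \<Lambda> * sqrt (pi / p)" .
    define I where "I = (LINT y:{0..}|lborel. (of_real a + of_real y * \<i>) * kern n d (of_real a + of_real y * \<i>))"
    have "(\<integral>v. E v \<partial>lborel) = (\<integral>y. g y \<partial>lborel)"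
      using lborel_integral_real_affine[of 1 g b] by (simp add: E_def)
    also have "\<dots> = (\<integral>y. 1 / (w0 * k0) * (indicator {0..} y *\<^sub>R (Complex a y * kern n d (Complex a y))) \<partial>lborel)"
      by (intro Bochner_Integration.integral_cong) (auto simp: g_def)
    also have "\<dots> = 1 / (w0 * k0) * I"
      unfolding I_def set_lebesgue_integral_def Cxy by (rule integral_mult_right_zero)
    finally have "(\<integral>v. E v \<partial>lborel) = 1 / (w0 * k0) * I" .
    then have I_eq: "I = w0 * k0 * (\<integral>v. E v \<partial>lborel)" using w0_nz k0_nz by simp
    have "I - w0 * k0 * (of_real (sqrt pi) / csqrt z) = w0 * k0 * ((\<integral>v. E v \<partial>lborel) - of_real (sqrt pi) / csqrt z)"
      unfolding I_eq by (simp only: right_diff_distrib)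
    then have "cmod (I - w0 * k0 * (of_real (sqrt pi) / csqrt z)) \<le> cmod (w0 * k0) * (C / \<Lambda> * sqrt (pi / p))"
      using est by (simp only: norm_mult[of "w0 * k0"]) (rule mult_left_mono, auto)
    also have "C / \<Lambda> * sqrt (pi / p) = C * sqrt (18 * pi / b0\<^sup>2) / \<Lambda> / sqrt \<Lambda>"
    proof -
      have "pi / p = 18 * pi / b0\<^sup>2 / \<Lambda>" by (simp add: p_def)
      then show ?thesis by (simp only: real_sqrt_divide) simp
    qed
    finally show "cmod ((LINT y:{0..}|lborel. (of_real a + of_real y * \<i>) * kern n d (of_real a + of_real y * \<i>))
        - Complex a b * kern n d (Complex a b) *
          (of_real (sqrt pi) / csqrt (of_real (real n * d) * (3 - 2 * of_real (d\<^sup>2) * Complex a b))))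
      \<le> cmod (Complex a b * kern n d (Complex a b)) * (C * sqrt (18 * pi / b0\<^sup>2) / (real n * d) / sqrt (real n * d))"
      unfolding I_def z_def k0_def w0_def \<Lambda>_def .
  qed
qed

section \<open>The saddle point and the square root as functions of the parameter\<close>

lemma saddle_real_part_mono:
  fixes x y :: real
  assumes "x > 0" "y > 0" "3 * x\<^sup>2 > 1" "3 * y\<^sup>2 > 1" "8 * x ^ 3 - 2 * x \<le> 8 * y ^ 3 - 2 * y"
  shows "x \<le> y"
proof (rule ccontr)
  assume "\<not> x \<le> y"
  then have "x - y > 0" by simp
  moreover have "0 < 8 * (x\<^sup>2 + x * y + y\<^sup>2) - 2"
  proof -
    have "8 * (x\<^sup>2 + x * y + y\<^sup>2) - 2 = 8 * x\<^sup>2 + 8 * (x * y) + 8 * y\<^sup>2 - 2"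
      by (simp add: algebra_simps)
    then show ?thesis using assms(3,4) mult_pos_pos[OF assms(1,2)] by linarith
  qed
  ultimately have "0 < (x - y) * (8 * (x\<^sup>2 + x * y + y\<^sup>2) - 2)" by (rule mult_pos_pos)
  also have "\<dots> = (8 * x ^ 3 - 2 * x) - (8 * y ^ 3 - 2 * y)"
    by (simp add: algebra_simps power2_eq_square power3_eq_cube)
  finally show False using assms(5) by simp
qed

text \<open>The imaginary part of \<open>\<alpha> * (z ^ 3 - z) + 1 = 0\<close> determines \<open>Im z\<close> from \<open>x = Re z\<close>, and what remains is
\<open>\<alpha> * (8 * x ^ 3 - 2 * x) = 1\<close> with \<open>3 * x\<^sup>2 > 1\<close>. At \<open>x = 1 / sqrt 3\<close> the polynomial equals
\<open>1 / alpha_c\<close>, which is where the critical parameter comes from.\<close>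

lemma saddle_real_part_exists:
  assumes \<alpha>: "0 < \<alpha>" "\<alpha> < alpha_c"
  obtains x where "x > 0" "3 * x\<^sup>2 > 1" "\<alpha> * (8 * x ^ 3 - 2 * x) = 1"
proof -
  define c where "c = 1 / sqrt 3"
  have c: "c > 0" "c\<^sup>2 = 1 / 3" by (simp_all add: c_def power_divide)
  define f where "f x = 8 * x ^ 3 - 2 * x" for x :: real
  have f_alt: "f x = x * (8 * x\<^sup>2 - 2)" for x by (simp add: f_def power2_eq_square power3_eq_cube algebra_simps)
  have fc: "f c = 2 / 3 * c" by (simp add: f_alt c)
  have "alpha_c * f c = 1"
    unfolding fc by (simp add: alpha_c_def c_def)
  moreover have "\<alpha> * f c < alpha_c * f c" using \<alpha> c fc by (intro mult_strict_right_mono) auto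
  ultimately have low: "f c < 1 / \<alpha>" using \<alpha> by (simp add: field_simps)
  \<comment> \<open>Beyond \<open>c\<close> the polynomial is at least \<open>2 / 3 * x\<close>, so it exceeds \<open>1 / \<alpha>\<close> at \<open>X\<close>.\<close>
  define X where "X = c + 2 / \<alpha>"
  have X: "X \<ge> c" "X > 0" using \<alpha> c by (auto simp: X_def add_pos_pos)
  have "c\<^sup>2 \<le> X\<^sup>2" using X c by (intro power_mono) auto
  then have "8 * X\<^sup>2 - 2 \<ge> 2 / 3" using c by simp
  then have "X * (2 / 3) \<le> f X" unfolding f_alt using X by (intro mult_left_mono) auto
  moreover have "1 / \<alpha> \<le> X * (2 / 3)" using \<alpha> c by (simp add: X_def field_simps)
  ultimately have high: "1 / \<alpha> \<le> f X" by simp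
  have "continuous_on {c..X} f" unfolding f_def by (intro continuous_intros)
  with IVT'[of f c "1 / \<alpha>" X] low high X obtain x where x: "c \<le> x" "x \<le> X" "f x = 1 / \<alpha>" by auto
  have "x \<noteq> c" using x low by auto
  then have "c < x" using x by simp
  then have "c\<^sup>2 < x\<^sup>2" using c by (intro power_strict_mono) auto
  with c have "3 * x\<^sup>2 > 1" by simp
  moreover have "\<alpha> * (8 * x ^ 3 - 2 * x) = 1" using x \<alpha> by (simp add: f_def)
  ultimately show ?thesis using that[of x] \<open>c < x\<close> c by simp
qed

lemma zeta_eqI:
  assumes \<alpha>: "0 < \<alpha>" and x: "x > 0" "3 * x\<^sup>2 > 1" "\<alpha> * (8 * x ^ 3 - 2 * x) = 1"
  shows "zeta \<alpha> = Complex x (sqrt (3 * x\<^sup>2 - 1))"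
  unfolding zeta_def
proof (rule the_equality)
  have Re_eq: "Re (of_real \<alpha> * (Complex s t ^ 3 - Complex s t) + 1) = \<alpha> * (s ^ 3 - 3 * s * t\<^sup>2 - s) + 1" for s t
    by (simp add: power2_eq_square power3_eq_cube algebra_simps)
  have Im_eq: "Im (of_real \<alpha> * (Complex s t ^ 3 - Complex s t) + 1) = \<alpha> * t * (3 * s\<^sup>2 - t\<^sup>2 - 1)" for s t
    by (simp add: power2_eq_square power3_eq_cube algebra_simps)
  have reduce: "\<alpha> * (s ^ 3 - 3 * s * t\<^sup>2 - s) + 1 = 1 - \<alpha> * (8 * s ^ 3 - 2 * s)" if "t\<^sup>2 = 3 * s\<^sup>2 - 1" for s t
    unfolding that by (simp add: power2_eq_square power3_eq_cube algebra_simps)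
  define y where "y = sqrt (3 * x\<^sup>2 - 1)"
  have y: "y > 0" "y\<^sup>2 = 3 * x\<^sup>2 - 1" using x by (simp_all add: y_def)
  have "of_real \<alpha> * (Complex x y ^ 3 - Complex x y) + 1 = 0"
  proof (rule complex_eqI)
    show "Re (of_real \<alpha> * (Complex x y ^ 3 - Complex x y) + 1) = Re 0"
      unfolding Re_eq reduce[OF y(2)] x(3) by simp
    show "Im (of_real \<alpha> * (Complex x y ^ 3 - Complex x y) + 1) = Im 0"
      unfolding Im_eq y(2) by simp
  qed
  then show "Re (Complex x (sqrt (3 * x\<^sup>2 - 1))) > 0 \<and> Im (Complex x (sqrt (3 * x\<^sup>2 - 1))) > 0 \<and>
      of_real \<alpha> * (Complex x (sqrt (3 * x\<^sup>2 - 1)) ^ 3 - Complex x (sqrt (3 * x\<^sup>2 - 1))) + 1 = 0"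
    using x y unfolding y_def[symmetric] by simp
  fix z assume z: "Re z > 0 \<and> Im z > 0 \<and> of_real \<alpha> * (z ^ 3 - z) + 1 = 0"
  obtain s t where st: "z = Complex s t" by (cases z)
  have st_pos: "s > 0" "t > 0" using z by (simp_all add: st)
  have "\<alpha> * t * (3 * s\<^sup>2 - t\<^sup>2 - 1) = 0" using z Im_eq[of s t] by (simp only: st) simp
  then have t2: "t\<^sup>2 = 3 * s\<^sup>2 - 1" using \<alpha> st_pos by simp
  have "1 - \<alpha> * (8 * s ^ 3 - 2 * s) = 0"
    using z Re_eq[of s t] unfolding reduce[OF t2] by (simp only: st) simp
  with x(3) have "\<alpha> * (8 * s ^ 3 - 2 * s) = \<alpha> * (8 * x ^ 3 - 2 * x)" by simp
  then have eq: "8 * s ^ 3 - 2 * s = 8 * x ^ 3 - 2 * x" by (rule mult_left_cancel[OF less_imp_neq[OF \<alpha>, THEN not_sym], THEN iffD1])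
  have s2: "3 * s\<^sup>2 > 1" using t2 zero_less_power[OF st_pos(2), of 2] by simp
  have "s = x"
    using saddle_real_part_mono[of s x] saddle_real_part_mono[of x s] eq x s2 st_pos by simp
  moreover have "t = sqrt (3 * x\<^sup>2 - 1)"
    using t2 st_pos calculation by (metis less_imp_le real_sqrt_unique)
  ultimately show "z = Complex x (sqrt (3 * x\<^sup>2 - 1))" by (simp add: st)
qed

text \<open>The real part of \<open>zeta \<alpha>\<close> decreases in \<open>\<alpha>\<close>, so it is at least its value \<open>x0\<close> at \<open>\<alpha>0\<close>. As
\<open>b\<^sup>2 = a\<^sup>2 * (3 - 1 / x\<^sup>2)\<close> and \<open>a \<ge> 1 / 2\<close>, this bounds \<open>b\<close> from below uniformly.\<close>

lemma scaled_saddle_zeta: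
  assumes \<alpha>0: "0 < \<alpha>0" "\<alpha>0 < alpha_c"
  obtains b0 where "b0 > 0" and
    "\<And>\<alpha>. \<lbrakk>0 < \<alpha>; \<alpha> \<le> \<alpha>0\<rbrakk> \<Longrightarrow>
       \<exists>d a b. d > 0 \<and> d ^ 3 = \<alpha> \<and> scaled_saddle d a b \<and> b0 \<le> b \<and> zeta \<alpha> = Complex a b / of_real d"
proof -
  obtain x0 where x0: "x0 > 0" "3 * x0\<^sup>2 > 1" "\<alpha>0 * (8 * x0 ^ 3 - 2 * x0) = 1"
    using saddle_real_part_exists[OF \<alpha>0] by blast
  define b0 where "b0 = sqrt ((3 - 1 / x0\<^sup>2) / 4)"
  have pos: "3 - 1 / x0\<^sup>2 > 0" using x0 by (simp add: field_simps)
  show ?thesis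
  proof (rule that)
    show "b0 > 0" using pos by (simp add: b0_def)
    fix \<alpha> :: real assume \<alpha>: "0 < \<alpha>" "\<alpha> \<le> \<alpha>0"
    obtain x where x: "x > 0" "3 * x\<^sup>2 > 1" "\<alpha> * (8 * x ^ 3 - 2 * x) = 1"
      using saddle_real_part_exists[of \<alpha>] \<alpha> \<alpha>0 by auto
    have "8 * x0 ^ 3 - 2 * x0 \<le> 8 * x ^ 3 - 2 * x"
    proof -
      have "8 * x0 ^ 3 - 2 * x0 = 1 / \<alpha>0" using x0(3) \<alpha>0 by (simp add: field_simps)
      also have "\<dots> \<le> 1 / \<alpha>" using \<alpha> by (simp add: frac_le)
      also have "\<dots> = 8 * x ^ 3 - 2 * x" using x(3) \<alpha> by (simp add: field_simps)
      finally show ?thesis .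
    qed
    then have x0_le: "x0 \<le> x" by (rule saddle_real_part_mono[OF x0(1) x(1) x0(2) x(2)])
    define d where "d = root 3 \<alpha>"
    have d: "d > 0" "d ^ 3 = \<alpha>" using \<alpha> by (simp_all add: d_def)
    define a b where "a = d * x" and "b = d * sqrt (3 * x\<^sup>2 - 1)"
    have b2: "b\<^sup>2 = 3 * a\<^sup>2 - d\<^sup>2"
      using x by (simp add: a_def b_def power_mult_distrib algebra_simps)
    have "8 * a ^ 3 - 2 * a * d\<^sup>2 = d ^ 3 * (8 * x ^ 3 - 2 * x)"
      by (simp add: a_def power_mult_distrib power2_eq_square power3_eq_cube algebra_simps)
    then have sad: "scaled_saddle d a b"
      using d x b2 by (simp add: scaled_saddle_def a_def b_def)
    have "b0 \<le> b"
    proof (rule power2_le_imp_le)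
      have "1 / x\<^sup>2 \<le> 1 / x0\<^sup>2" using x0_le x0 by (intro divide_left_mono power_mono) auto
      moreover have "(1 / 2)\<^sup>2 \<le> a\<^sup>2" using scaled_saddle_bounds(1)[OF sad] by (intro power_mono) auto
      ultimately have "(3 - 1 / x0\<^sup>2) * (1 / 2)\<^sup>2 \<le> (3 - 1 / x\<^sup>2) * a\<^sup>2"
        using pos by (intro mult_mono) auto
      also have "\<dots> = b\<^sup>2"
        using x(1) unfolding b2 a_def by (simp add: power_mult_distrib field_simps)
      finally show "b0\<^sup>2 \<le> b\<^sup>2" using pos by (simp add: b0_def power2_eq_square)
      show "0 \<le> b" using d x by (simp add: b_def)
    qed
    moreover have "zeta \<alpha> = Complex a b / of_real d"
      unfolding zeta_eqI[OF \<alpha>(1) x] using d(1) by (simp add: a_def b_def complex_eq_iff)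
    ultimately show "\<exists>d a b. d > 0 \<and> d ^ 3 = \<alpha> \<and> scaled_saddle d a b \<and> b0 \<le> b \<and> zeta \<alpha> = Complex a b / of_real d"
      using d sad by blast
  qed
qed

text \<open>The square of \<open>S \<alpha>\<close> has positive real part, so \<open>S \<alpha>\<close> is never purely imaginary; by continuity the sign of
its real part is the one near 0.\<close>

lemma sqrt_branch_Re_pos:
  assumes S: "is_sqrt_branch S" and \<alpha>: "0 < \<alpha>" "\<alpha> < alpha_c"
  shows "Re (S \<alpha>) > 0"
proof (rule ccontr)
  assume neg: "\<not> Re (S \<alpha>) > 0"
  have nz: "Re (S t) \<noteq> 0" if t: "0 < t" "t < alpha_c" for t
  proof
    assume Re0: "Re (S t) = 0"
    obtain b0 where "\<And>\<alpha>. \<lbrakk>0 < \<alpha>; \<alpha> \<le> t\<rbrakk> \<Longrightarrow>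
       \<exists>d a b. d > 0 \<and> d ^ 3 = \<alpha> \<and> scaled_saddle d a b \<and> b0 \<le> b \<and> zeta \<alpha> = Complex a b / of_real d"
      using scaled_saddle_zeta[OF t] by blast
    from this[OF t(1) order_refl]
    obtain d a b where d: "d > 0" "d ^ 3 = t" and sad: "scaled_saddle d a b"
      and zeta: "zeta t = Complex a b / of_real d" by blast
    have "(S t)\<^sup>2 = 3 - 2 * of_real t * zeta t"
      using S t by (simp add: is_sqrt_branch_def)
    also have "\<dots> = 3 - 2 * of_real (d\<^sup>2) * Complex a b"
      unfolding zeta using d(1) by (simp add: d(2)[symmetric] power2_eq_square power3_eq_cube)
    finally have "Re ((S t)\<^sup>2) > 0" using saddle_hessian(2)[OF sad] by simp
    with Re0 show False by (simp add: power2_eq_square)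
  qed
  have "((\<lambda>t. Re (S t)) \<longlongrightarrow> sqrt 3) (at_right 0)"
    using tendsto_Re[of S "of_real (sqrt 3)"] S by (simp add: is_sqrt_branch_def)
  then have "\<forall>\<^sub>F t in at_right 0. Re (S t) > 0"
    by (rule order_tendstoD) simp
  moreover have "\<forall>\<^sub>F t in at_right 0. t \<in> {0<..<\<alpha>}"
    using eventually_at_right_real[OF \<alpha>(1)] .
  ultimately have "\<forall>\<^sub>F t in at_right 0. Re (S t) > 0 \<and> t \<in> {0<..<\<alpha>}"
    by (rule eventually_conj)
  then have "\<exists>t. Re (S t) > 0 \<and> t \<in> {0<..<\<alpha>}"
    by (rule eventually_happens'[rotated]) simp
  then obtain t where t: "Re (S t) > 0" "0 < t" "t < \<alpha>" by auto
  have "continuous_on {t..\<alpha>} (\<lambda>s. Re (S s))"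
    using S t \<alpha> unfolding is_sqrt_branch_def
    by (intro continuous_on_Re) (auto elim!: continuous_on_subset)
  then obtain s where "t \<le> s" "s \<le> \<alpha>" "Re (S s) = 0"
    using IVT2'[of "\<lambda>s. Re (S s)" \<alpha> 0 t] t neg by auto
  with nz[of s] t \<alpha> show False by auto
qed

section \<open>The asymptotic formula\<close>

text \<open>The connection with the unscaled quantities: the value of \<open>kern\<close> at the scaled saddle carries both
the exponential rate and the oscillating phase.\<close>

lemma kern_eq_exp_psi:
  assumes d: "d > 0" "d ^ 3 = \<alpha>" and w0: "Im w0 > 0" and zeta: "zeta \<alpha> = w0 / of_real d"
  shows "kern n d w0 = of_real (H_e \<alpha> ^ n) * exp (\<i> * of_real (real n * Theta \<alpha>))"
proof -
  have nz: "w0 - of_real d \<noteq> 0" "w0 + of_real d \<noteq> 0"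
    using w0 by (auto simp: complex_eq_iff)
  have z1: "(zeta \<alpha> - 1) / (zeta \<alpha> + 1) = (w0 - of_real d) / (w0 + of_real d)"
  proof -
    have "(w0 / of_real d - 1) / (w0 / of_real d + 1) = ((w0 - of_real d) / of_real d) / ((w0 + of_real d) / of_real d)"
      using d(1) by (simp add: diff_divide_distrib add_divide_distrib)
    then show ?thesis using d(1) unfolding zeta by simp
  qed
  have z2: "of_nat n * (of_real \<alpha> * (zeta \<alpha>)\<^sup>2) = of_real (real n * d) * w0\<^sup>2"
    unfolding zeta using d(1) by (simp add: d(2)[symmetric] power2_eq_square power3_eq_cube)
  have "exp (of_nat n * psi \<alpha> (zeta \<alpha>)) = exp (Ln ((w0 - of_real d) / (w0 + of_real d))) ^ n * exp (of_real (real n * d) * w0\<^sup>2)"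
    unfolding psi_def z1 distrib_left z2 exp_add exp_of_nat_mult ..
  also have "\<dots> = kern n d w0" using nz by (simp add: kern_def)
  finally have "kern n d w0 = exp (of_nat n * psi \<alpha> (zeta \<alpha>))" ..
  also have "of_nat n * psi \<alpha> (zeta \<alpha>) = of_real (real n * Re (psi \<alpha> (zeta \<alpha>))) + \<i> * of_real (real n * Theta \<alpha>)"
    by (simp add: complex_eq_iff Theta_def)
  also have "exp \<dots> = of_real (H_e \<alpha> ^ n) * exp (\<i> * of_real (real n * Theta \<alpha>))"
    unfolding exp_add H_e_def exp_of_real exp_of_nat_mult[symmetric] ..
  finally show ?thesis .
qed

text \<open>Collects the factor \<open>4 / pi * d\<close> in front of the integral, the amplitude \<open>w0\<close> and the Gaussian integral
into \<open>amp_C\<close>.\<close>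

lemma amp_C_scaled:
  assumes d: "d > 0" "d ^ 3 = \<alpha>" and zeta: "zeta \<alpha> = w0 / of_real d" and n: "n \<ge> 1" and s_nz: "S \<alpha> \<noteq> 0"
  shows "of_real (4 / pi * d) * (w0 * k0 * (of_real (sqrt pi) / (of_real (sqrt (real n * d)) * S \<alpha>)))
    = of_real (real n powr (-1 / 2)) * amp_C S \<alpha> * k0"
proof -
  define s where "s = S \<alpha>"
  have n_powr: "real n powr (-1 / 2) = 1 / sqrt (real n)"
  proof -
    have "real n powr (- (1 / 2)) = inverse (real n powr (1 / 2))" by (rule powr_minus)
    then show ?thesis by (simp add: powr_half_sqrt inverse_eq_divide)
  qed
  have root_\<alpha>: "sqrt \<alpha> = sqrt d * sqrt d * sqrt d"
    using d(1) by (simp add: d(2)[symmetric] power3_eq_cube real_sqrt_mult)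
  have alg: "4 / (p * p) * (r * r) * (w0 * k0 * (p / (t * r * s))) =
      1 / t * (4 * (r * r * r) / p * (w0 / (r * r) / s)) * k0"
    if "p \<noteq> 0" "r \<noteq> 0" "t \<noteq> 0" for p r t :: complex
    using that s_nz by (simp add: s_def mult_ac)
  define p r t where "p = complex_of_real (sqrt pi)" and "r = complex_of_real (sqrt d)"
    and "t = complex_of_real (sqrt (real n))"
  have nz: "p \<noteq> 0" "r \<noteq> 0" "t \<noteq> 0" using d(1) n by (simp_all add: p_def r_def t_def)
  have "p * p = of_real pi" "r * r = of_real d"
    using d(1) by (simp_all add: p_def r_def flip: of_real_mult)
  then have "of_real (4 / pi * d) = 4 / (p * p) * (r * r)" by simp
  moreover have "of_real (sqrt (real n * d)) = t * r"
    by (simp add: t_def r_def real_sqrt_mult)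
  moreover have "of_real (real n powr (-1 / 2)) = 1 / t" unfolding n_powr t_def by simp
  moreover have "amp_C S \<alpha> = 4 * (r * r * r) / p * (w0 / (r * r) / s)"
  proof -
    have dd: "of_real d = r * r" using d(1) by (simp add: r_def flip: of_real_mult)
    have e: "of_real (4 * (sqrt d * sqrt d * sqrt d) / sqrt pi) = 4 * (r * r * r) / p"
      by (simp only: of_real_mult of_real_divide of_real_numeral r_def p_def)
    show ?thesis unfolding amp_C_def zeta root_\<alpha> e dd s_def ..
  qed
  ultimately show ?thesis using alg[OF nz] by (simp only: p_def[symmetric] s_def[symmetric])
qed

text \<open>The coefficient is the real part of a complex integral, whose main term \<open>m\<close> has modulus
\<open>P = n powr (-1/2) * amp_B * H_e ^ n\<close>. As the error is relative to \<open>\<bar>m\<bar>\<close>, division by \<open>P\<close> is harmless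
even where the cosine vanishes.\<close>

lemma cheb_coeff_saddle_form:
  assumes \<alpha>\<^sub>0: "0 < \<alpha>\<^sub>0" "\<alpha>\<^sub>0 < alpha_c" and S: "is_sqrt_branch S" and \<beta>: "is_arg_branch S \<beta>"
  shows "\<exists>K. \<forall>n l. n \<ge> 1 \<longrightarrow> l > 0 \<longrightarrow> l / real n \<le> \<alpha>\<^sub>0 \<longrightarrow>
    (\<exists>\<rho>. cheb_coeff n l = (-1) ^ n * real n powr (-1 / 2) * amp_B S (l / real n) * H_e (l / real n) ^ n *
          (cos (real n * Theta (l / real n) + \<beta> (l / real n)) + \<rho>) \<and> \<bar>\<rho>\<bar> \<le> K / ((l * (real n)\<^sup>2) powr (1 / 3)))"
proof (rule scaled_saddle_zeta[OF \<alpha>\<^sub>0])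
  fix b0 :: real
  assume b0: "b0 > 0" and saddle: "\<And>\<alpha>. \<lbrakk>0 < \<alpha>; \<alpha> \<le> \<alpha>\<^sub>0\<rbrakk> \<Longrightarrow>
       \<exists>d a b. d > 0 \<and> d ^ 3 = \<alpha> \<and> scaled_saddle d a b \<and> b0 \<le> b \<and> zeta \<alpha> = Complex a b / of_real d"
  show ?thesis
  proof (rule saddle_integral_estimate[OF b0])
    fix K :: real
    assume K: "K \<ge> 0" and estimate:
      "\<And>d a b n. \<lbrakk>scaled_saddle d a b; b0 \<le> b; n \<ge> 1\<rbrakk> \<Longrightarrow>
        cmod ((LINT y:{0..}|lborel. (of_real a + of_real y * \<i>) * kern n d (of_real a + of_real y * \<i>))
          - Complex a b * kern n d (Complex a b) *
            (of_real (sqrt pi) / csqrt (of_real (real n * d) * (3 - 2 * of_real (d\<^sup>2) * Complex a b))))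
        \<le> cmod (Complex a b * kern n d (Complex a b)) * (K / (real n * d) / sqrt (real n * d))"
    show ?thesis
    proof (rule exI[of _ "4 * K"], intro allI impI)
      fix n :: nat and l :: real
      assume n: "n \<ge> 1" and l: "l > 0" and le: "l / real n \<le> \<alpha>\<^sub>0"
      define \<alpha> where "\<alpha> = l / real n"
      have \<alpha>_le: "\<alpha> \<le> \<alpha>\<^sub>0" using le by (simp add: \<alpha>_def)
      have \<alpha>: "\<alpha> > 0" "\<alpha> < alpha_c" using n l \<alpha>_le \<alpha>\<^sub>0(2) by (auto simp: \<alpha>_def)
      obtain d a b where d: "d > 0" "d ^ 3 = \<alpha>" and sad: "scaled_saddle d a b" and b: "b0 \<le> b"
        and zeta: "zeta \<alpha> = Complex a b / of_real d"
        using saddle[OF \<alpha>(1) \<alpha>_le] by blast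
      have a: "a > 0" and b_pos: "b > 0" using sad by (auto simp: scaled_saddle_def)
      define w0 where "w0 = Complex a b"
      define k0 where "k0 = kern n d w0"
      define \<Lambda> where "\<Lambda> = real n * d"
      have \<Lambda>: "\<Lambda> > 0" using d n by (simp add: \<Lambda>_def)
      have l_eq: "l = real n * d ^ 3" using n by (simp add: d(2) \<alpha>_def)
      have \<Lambda>_eq: "(l * (real n)\<^sup>2) powr (1 / 3) = \<Lambda>"
      proof -
        have "l * (real n)\<^sup>2 = \<Lambda> ^ 3"
          by (simp add: l_eq \<Lambda>_def power_mult_distrib power2_eq_square power3_eq_cube)
        also have "\<dots> = \<Lambda> powr 3" using \<Lambda> by (simp add: powr_numeral)
        finally have "(l * (real n)\<^sup>2) powr (1 / 3) = \<Lambda> powr (3 * (1 / 3))"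
          by (simp only: powr_powr)
        then show ?thesis using \<Lambda> by simp
      qed
      define s where "s = S \<alpha>"
      have Re_s: "Re s > 0" unfolding s_def by (rule sqrt_branch_Re_pos[OF S \<alpha>])
      have s2: "s\<^sup>2 = 3 - 2 * of_real (d\<^sup>2) * w0"
      proof -
        have "s\<^sup>2 = 3 - 2 * of_real \<alpha> * zeta \<alpha>"
          using S \<alpha> by (simp add: is_sqrt_branch_def s_def)
        also have "\<dots> = 3 - 2 * of_real (d\<^sup>2) * w0"
          unfolding zeta w0_def using d(1) by (simp add: d(2)[symmetric] power2_eq_square power3_eq_cube)
        finally show ?thesis .
      qed
      have norm_s: "cmod s \<le> 4"
      proof (rule power2_le_imp_le)
        show "(cmod s)\<^sup>2 \<le> 4\<^sup>2"
          using saddle_hessian(3)[OF sad] by (simp add: norm_power[symmetric] s2 w0_def)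
      qed simp
      have s_nz: "s \<noteq> 0" using Re_s by auto
      have root_eq: "csqrt (of_real \<Lambda> * (3 - 2 * of_real (d\<^sup>2) * w0)) = of_real (sqrt \<Lambda>) * s"
      proof -
        have "of_real \<Lambda> * (3 - 2 * of_real (d\<^sup>2) * w0) = (of_real (sqrt \<Lambda>) * s)\<^sup>2"
          unfolding power_mult_distrib s2[symmetric] of_real_power[symmetric] using \<Lambda> by simp
        moreover have "csqrt ((of_real (sqrt \<Lambda>) * s)\<^sup>2) = of_real (sqrt \<Lambda>) * s"
          by (rule csqrt_square) (use \<Lambda> Re_s in simp)
        ultimately show ?thesis by (simp only:)
      qed
      define A where "A = 4 / pi * d"
      have A: "A > 0" using d by (simp add: A_def)
      define I where "I = (LINT y:{0..}|lborel. (of_real a + of_real y * \<i>) * kern n d (of_real a + of_real y * \<i>))"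
      define m where "m = of_real A * (w0 * k0 * (of_real (sqrt pi) / (of_real (sqrt \<Lambda>) * s)))"
      have cheb: "cheb_coeff n l = (-1) ^ n * Re (of_real A * I)"
        using cheb_coeff_eq_half_line[OF d(1) n] kern_integral_shift[OF d(1) n less_imp_le[OF a]]
        by (simp add: l_eq A_def I_def)
      have norm_m: "cmod m = A * cmod (w0 * k0) * (sqrt pi / (sqrt \<Lambda> * cmod s))"
        using A \<Lambda> by (simp add: m_def norm_mult norm_divide)
      have err: "cmod (of_real A * I - m) \<le> cmod m * (4 * K / \<Lambda>)"
      proof -
        have "cmod (of_real A * I - m) = A * cmod (I - w0 * k0 * (of_real (sqrt pi) / (of_real (sqrt \<Lambda>) * s)))"
          unfolding m_def right_diff_distrib[symmetric] using A by (simp add: norm_mult)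
        also have "\<dots> \<le> A * (cmod (w0 * k0) * (K / \<Lambda> / sqrt \<Lambda>))"
          using estimate[OF sad b n] A
          unfolding w0_def[symmetric] k0_def[symmetric] \<Lambda>_def[symmetric] root_eq I_def[symmetric]
          by (intro mult_left_mono) auto
        also have "\<dots> = cmod m * (cmod s / sqrt pi * (K / \<Lambda>))"
        proof -
          have "A * (W * (k / l / r)) = A * W * (p / (r * t)) * (t / p * (k / l))"
            if "p \<noteq> 0" "t \<noteq> 0" for W k l r p t :: real
            using that by simp
          then show ?thesis unfolding norm_m using s_nz by simp
        qed
        also have "\<dots> \<le> cmod m * (4 / 1 * (K / \<Lambda>))"
          using norm_s K \<Lambda> pi_gt3 by (intro mult_left_mono mult_right_mono frac_le) auto
        finally show ?thesis by simp
      qed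
      define P where "P = real n powr (-1 / 2) * amp_B S \<alpha> * H_e \<alpha> ^ n"
      have psi: "k0 = of_real (H_e \<alpha> ^ n) * exp (\<i> * of_real (real n * Theta \<alpha>))"
        unfolding k0_def by (rule kern_eq_exp_psi[OF d _ zeta[folded w0_def]]) (use b_pos in \<open>simp add: w0_def\<close>)
      have m_eq: "m = of_real (real n powr (-1 / 2)) * amp_C S \<alpha> * k0"
        unfolding m_def A_def \<Lambda>_def s_def
        by (rule amp_C_scaled[OF d zeta[folded w0_def] n]) (use s_nz in \<open>simp add: s_def\<close>)
      have "amp_C S \<alpha> = of_real (amp_B S \<alpha>) * exp (\<i> * of_real (\<beta> \<alpha>))"
        using \<beta> \<alpha> by (simp add: is_arg_branch_def)
      then have "m = of_real P * exp (\<i> * of_real (real n * Theta \<alpha> + \<beta> \<alpha>))"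
        unfolding m_eq psi P_def by (simp add: exp_add distrib_left)
      then have Re_m: "Re m = P * cos (real n * Theta \<alpha> + \<beta> \<alpha>)" and norm_m': "cmod m = \<bar>P\<bar>"
        by (simp_all add: Re_exp norm_mult)
      have "P \<ge> 0" unfolding P_def H_e_def amp_B_def by simp
      have "w0 \<noteq> 0" "k0 \<noteq> 0"
        using a b_pos kern_nonzero[of w0 n d] by (auto simp: w0_def k0_def complex_eq_iff)
      then have "cmod m > 0" unfolding norm_m using A \<Lambda> s_nz by simp
      with norm_m' \<open>P \<ge> 0\<close> have P: "P > 0" "cmod m = P" by auto
      define \<rho> where "\<rho> = (Re (of_real A * I) - Re m) / P"
      have "Re (of_real A * I) = P * (cos (real n * Theta \<alpha> + \<beta> \<alpha>) + \<rho>)"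
        using P Re_m by (simp add: \<rho>_def distrib_left)
      then have "cheb_coeff n l = (-1) ^ n * real n powr (-1 / 2) * amp_B S \<alpha> * H_e \<alpha> ^ n *
            (cos (real n * Theta \<alpha> + \<beta> \<alpha>) + \<rho>)"
        unfolding cheb by (simp add: P_def mult.assoc)
      moreover have "\<bar>\<rho>\<bar> \<le> 4 * K / \<Lambda>"
      proof -
        have "\<bar>Re (of_real A * I) - Re m\<bar> \<le> P * (4 * K / \<Lambda>)"
          using order_trans[OF abs_Re_le_cmod[of "of_real A * I - m"] err] P by simp
        then show ?thesis using P by (simp add: \<rho>_def divide_le_eq mult.commute)
      qed
      ultimately show "\<exists>\<rho>. cheb_coeff n l = (-1) ^ n * real n powr (-1 / 2) * amp_B S (l / real n) * H_e (l / real n) ^ n *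
            (cos (real n * Theta (l / real n) + \<beta> (l / real n)) + \<rho>) \<and> \<bar>\<rho>\<bar> \<le> 4 * K / ((l * (real n)\<^sup>2) powr (1 / 3))"
        unfolding \<Lambda>_eq \<alpha>_def by blast
    qed
  qed
qed

theorem proposition4p1:
  fixes \<alpha>\<^sub>0 :: real and S :: "real \<Rightarrow> complex" and \<beta> :: "real \<Rightarrow> real"
  assumes "0 < \<alpha>\<^sub>0" and "\<alpha>\<^sub>0 < alpha_c"
    and "is_sqrt_branch S" and "is_arg_branch S \<beta>"
  shows "\<exists>K L :: real. \<forall>(lam :: nat \<Rightarrow> real) (\<Lambda> :: nat \<Rightarrow> real) (\<alpha> :: nat \<Rightarrow> real).
    (\<forall>n\<ge>1. \<alpha> n = lam n / real n \<and> \<Lambda> n = (lam n * (real n)\<^sup>2) powr (1 / 3)) \<longrightarrow>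
    (\<forall>n\<ge>1. 0 < lam n \<and> 0 < \<alpha> n \<and> \<alpha> n \<le> \<alpha>\<^sub>0) \<longrightarrow>
    filterlim \<Lambda> at_top sequentially \<longrightarrow>
    (\<exists>r :: nat \<Rightarrow> real.
      (\<forall>n\<ge>1. cheb_coeff n (lam n) =
        (-1) ^ n * real n powr (-1 / 2) * amp_B S (\<alpha> n) * H_e (\<alpha> n) ^ n *
          (cos (real n * Theta (\<alpha> n) + \<beta> (\<alpha> n)) + r n)) \<and>
      (\<forall>n\<ge>1. \<Lambda> n \<ge> L \<longrightarrow> \<bar>r n\<bar> \<le> K / \<Lambda> n))"
proof -
  from cheb_coeff_saddle_form[OF assms]
  obtain K where main: "\<forall>n l. n \<ge> 1 \<longrightarrow> l > 0 \<longrightarrow> l / real n \<le> \<alpha>\<^sub>0 \<longrightarrow>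
    (\<exists>\<rho>. cheb_coeff n l = (-1) ^ n * real n powr (-1 / 2) * amp_B S (l / real n) * H_e (l / real n) ^ n *
          (cos (real n * Theta (l / real n) + \<beta> (l / real n)) + \<rho>) \<and> \<bar>\<rho>\<bar> \<le> K / ((l * (real n)\<^sup>2) powr (1 / 3)))" ..
  show ?thesis
  proof (rule exI[of _ K], rule exI[of _ 0], intro allI impI)
    fix lam \<Lambda> \<alpha> :: "nat \<Rightarrow> real"
    assume 1: "\<forall>n\<ge>1. \<alpha> n = lam n / real n \<and> \<Lambda> n = (lam n * (real n)\<^sup>2) powr (1 / 3)"
      and 2: "\<forall>n\<ge>1. 0 < lam n \<and> 0 < \<alpha> n \<and> \<alpha> n \<le> \<alpha>\<^sub>0"
    have "\<forall>n. \<exists>\<rho>. n \<ge> 1 \<longrightarrow> cheb_coeff n (lam n) =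
        (-1) ^ n * real n powr (-1 / 2) * amp_B S (\<alpha> n) * H_e (\<alpha> n) ^ n *
          (cos (real n * Theta (\<alpha> n) + \<beta> (\<alpha> n)) + \<rho>) \<and> \<bar>\<rho>\<bar> \<le> K / \<Lambda> n"
    proof
      fix n
      show "\<exists>\<rho>. n \<ge> 1 \<longrightarrow> cheb_coeff n (lam n) =
        (-1) ^ n * real n powr (-1 / 2) * amp_B S (\<alpha> n) * H_e (\<alpha> n) ^ n *
          (cos (real n * Theta (\<alpha> n) + \<beta> (\<alpha> n)) + \<rho>) \<and> \<bar>\<rho>\<bar> \<le> K / \<Lambda> n"
      proof (cases "n \<ge> 1")
        case True
        with 1 2 have lam: "0 < lam n" and \<alpha>: "\<alpha> n = lam n / real n" and le: "\<alpha> n \<le> \<alpha>\<^sub>0"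
          and \<Lambda>: "\<Lambda> n = (lam n * (real n)\<^sup>2) powr (1 / 3)" by auto
        from main[rule_format, OF True lam le[unfolded \<alpha>]] show ?thesis
          unfolding \<Lambda> \<alpha> by blast
      qed simp
    qed
    from choice[OF this] obtain r where r: "\<forall>n. n \<ge> 1 \<longrightarrow> cheb_coeff n (lam n) =
        (-1) ^ n * real n powr (-1 / 2) * amp_B S (\<alpha> n) * H_e (\<alpha> n) ^ n *
          (cos (real n * Theta (\<alpha> n) + \<beta> (\<alpha> n)) + r n) \<and> \<bar>r n\<bar> \<le> K / \<Lambda> n" ..
    show "\<exists>r. (\<forall>n\<ge>1. cheb_coeff n (lam n) =
        (-1) ^ n * real n powr (-1 / 2) * amp_B S (\<alpha> n) * H_e (\<alpha> n) ^ n *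
          (cos (real n * Theta (\<alpha> n) + \<beta> (\<alpha> n)) + r n)) \<and>
      (\<forall>n\<ge>1. \<Lambda> n \<ge> 0 \<longrightarrow> \<bar>r n\<bar> \<le> K / \<Lambda> n)"
      by (rule exI[of _ r]) (use r in simp)
  qed
qed

end
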